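(* Let $(M,g,J)$ be any almost Kähler $4$-manifold with scalar curvature $S\ge0$. Then $(M,g,J)$ is Kähler if and only if the equation $|W_+|^2=\dfrac{S^2}6$ is satisfied on $M$.
   Context: Almost Hermitian $4$-manifold: a smooth Riemannian manifold $(M,g)$ of real dimension $4$ with an endomorphism field $J$ of $TM$ satisfying $J^2=-1$, $J^*=-J$. Its fundamental form is $\Omega(X,Y)=g(JX,Y)$ and it is oriented by the volume form $\omega=\frac12\Omega\wedge\Omega$. It is almost Kähler if $d\Omega=0$, and Kähler if $\nabla J=0$, where $\nabla$ is the Levi-Civita connection. $(X_k)$ denotes a local orthonormal frame; repeated indices are summed. $R(X,Y)Z=\nabla^2_{X,Y}Z-\nabla^2_{Y,X}Z$ with $\nabla^2_{X,Y}=\nabla_X\circ\nabla_Y-\nabla_{\nabla_XY}$; $\mathrm{Ric}(X)=R(X,X_k)X_k$; $S=\mathrm{tr}(\mathrm{Ric})$. Skew-symmetric endomorphisms $A$ of $TM$ are identified with $2$-forms via $\Omega_A(X,Y)=g(AX,Y)$. The Weyl tensor $W$ (the totally trace-free part of $R$) acts on them by $W(A)=W(AX_k,X_k)$; it preserves the bundle $\Lambda^2_+$ of self-dual $2$-forms, and $W_+:\Lambda^2_+\to\Lambda^2_+$ is its restriction. $|W_+|^2=\mathrm{tr}(W_+\circ W_+)$. *)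

theory Defs
  imports "HOL-Analysis.Analysis"
begin

section \<open>Smooth maps between Euclidean spaces\<close>

(* On open S: all iterated partial derivatives up to order k exist and are continuous. *)
primrec Ck_on :: "nat \<Rightarrow> (real^'n) set \<Rightarrow> (real^'n \<Rightarrow> 'b::real_normed_vector) \<Rightarrow> bool" where
  "Ck_on 0 S f \<longleftrightarrow> continuous_on S f"
| "Ck_on (Suc k) S f \<longleftrightarrow> f differentiable_on S \<and>
     (\<forall>i. Ck_on k S (\<lambda>x. frechet_derivative f (at x) (axis i 1)))"

definition smooth_on :: "(real^'n) set \<Rightarrow> (real^'n \<Rightarrow> 'b::real_normed_vector) \<Rightarrow> bool" where
  "smooth_on S f \<longleftrightarrow> (\<forall>k. Ck_on k S f)"


section \<open>Smooth manifolds and tensor fields\<close>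

(* A chart (U, \<phi>); only the values of \<phi> on U matter. *)
type_synonym ('a, 'n) chart = "'a set \<times> ('a \<Rightarrow> real^'n)"

definition coords :: "('a, 'n::finite) chart \<Rightarrow> (real^'n) set" where
  "coords c = snd c ` fst c"

definition is_chart :: "'a topology \<Rightarrow> ('a, 'n::finite) chart \<Rightarrow> bool" where
  "is_chart M c \<longleftrightarrow> openin M (fst c) \<and> open (coords c) \<and>
     homeomorphic_map (subtopology M (fst c)) (top_of_set (coords c)) (snd c)"

definition overlap :: "('a, 'n::finite) chart \<Rightarrow> ('a, 'n) chart \<Rightarrow> (real^'n) set" where
  "overlap c c' = snd c ` (fst c \<inter> fst c')"

definition transition :: "('a, 'n::finite) chart \<Rightarrow> ('a, 'n) chart \<Rightarrow> real^'n \<Rightarrow> real^'n" where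
  "transition c c' = snd c' \<circ> inv_into (fst c) (snd c)"

definition smooth_manifold :: "'a topology \<Rightarrow> ('a, 'n::finite) chart set \<Rightarrow> bool" where
  "smooth_manifold M A \<longleftrightarrow> Hausdorff_space M \<and> second_countable M \<and>
     (\<forall>c\<in>A. is_chart M c) \<and> topspace M = (\<Union>c\<in>A. fst c) \<and>
     (\<forall>c\<in>A. \<forall>c'\<in>A. smooth_on (overlap c c') (transition c c'))"

definition jacobian_at :: "('a, 'n::finite) chart \<Rightarrow> ('a, 'n) chart \<Rightarrow> real^'n \<Rightarrow> real^'n^'n" where
  "jacobian_at c c' x = matrix (frechet_derivative (transition c c') (at x))"

(* A tensor field is given by its components in every chart of the atlas, as a function of the
   coordinates x \<in> coords c, subject to the transformation law on overlaps.  Values of T c outside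
   coords c are irrelevant. *)
type_synonym ('a, 'n) tensor2 = "('a, 'n) chart \<Rightarrow> real^'n \<Rightarrow> real^'n^'n"

(* Bilinear forms: (X, Y) maps to X \<bullet> (T c x *v Y). *)
definition bilinear_form_field :: "('a, 'n::finite) chart set \<Rightarrow> ('a, 'n) tensor2 \<Rightarrow> bool" where
  "bilinear_form_field A T \<longleftrightarrow>
     (\<forall>c\<in>A. smooth_on (coords c) (T c)) \<and>
     (\<forall>c\<in>A. \<forall>c'\<in>A. \<forall>x\<in>overlap c c'.
        T c x = transpose (jacobian_at c c' x) ** T c' (transition c c' x) ** jacobian_at c c' x)"

(* Endomorphisms of the tangent bundle: X maps to T c x *v X. *)
definition endomorphism_field :: "('a, 'n::finite) chart set \<Rightarrow> ('a, 'n) tensor2 \<Rightarrow> bool" where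
  "endomorphism_field A T \<longleftrightarrow>
     (\<forall>c\<in>A. smooth_on (coords c) (T c)) \<and>
     (\<forall>c\<in>A. \<forall>c'\<in>A. \<forall>x\<in>overlap c c'.
        jacobian_at c c' x ** T c x = T c' (transition c c' x) ** jacobian_at c c' x)"


section \<open>Riemannian geometry in a chart\<close>

(* In arguments of type matrix_field, g and J are the components of metric and almost complex structure in
   one chart.  Tangent vectors are coordinate vectors, vector fields are functions of the
   coordinates; a tensor at x is evaluated on vectors X, Y, ... by extending them to the
   fields \<lambda>_. X, \<lambda>_. Y, ... with constant coefficients. *)

type_synonym 'n matrix_field = "real^'n \<Rightarrow> real^'n^'n"

definition metric :: "'n::finite matrix_field \<Rightarrow> real^'n \<Rightarrow> real^'n \<Rightarrow> real^'n \<Rightarrow> real" where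
  "metric g x X Y = X \<bullet> (g x *v Y)"

definition dir_deriv :: "(real^'n::finite \<Rightarrow> 'b::real_normed_vector) \<Rightarrow> real^'n \<Rightarrow> real^'n \<Rightarrow> 'b" where
  "dir_deriv f x X = frechet_derivative f (at x) X"

definition riemannian_metric :: "('a, 'n::finite) chart set \<Rightarrow> ('a, 'n) tensor2 \<Rightarrow> bool" where
  "riemannian_metric A g \<longleftrightarrow> bilinear_form_field A g \<and>
     (\<forall>c\<in>A. \<forall>x\<in>coords c.
        (\<forall>X Y. metric (g c) x X Y = metric (g c) x Y X) \<and>
        (\<forall>X. X \<noteq> 0 \<longrightarrow> 0 < metric (g c) x X X))"

(* Christoffel symbols of the Levi-Civita connection: for constant X, Y, Z Koszul's formula reads
   2 g(\<Gamma>(X,Y), Z) = X g(Y,Z) + Y g(X,Z) - Z g(X,Y). *)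
definition christoffel :: "'n::finite matrix_field \<Rightarrow> real^'n \<Rightarrow> real^'n \<Rightarrow> real^'n \<Rightarrow> real^'n" where
  "christoffel g x X Y = matrix_inv (g x) *v
     (\<chi> k. (dir_deriv (\<lambda>y. metric g y Y (axis k 1)) x X
          + dir_deriv (\<lambda>y. metric g y X (axis k 1)) x Y
          - dir_deriv (\<lambda>y. metric g y X Y) x (axis k 1)) / 2)"

(* Levi-Civita covariant derivative of the vector field Y along the vector field X. *)
definition nabla ::
  "'n::finite matrix_field \<Rightarrow> (real^'n \<Rightarrow> real^'n) \<Rightarrow> (real^'n \<Rightarrow> real^'n) \<Rightarrow> real^'n \<Rightarrow> real^'n" where
  "nabla g X Y x = dir_deriv Y x (X x) + christoffel g x (X x) (Y x)"

definition nabla2 ::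
  "'n::finite matrix_field \<Rightarrow> (real^'n \<Rightarrow> real^'n) \<Rightarrow> (real^'n \<Rightarrow> real^'n) \<Rightarrow> (real^'n \<Rightarrow> real^'n)
     \<Rightarrow> real^'n \<Rightarrow> real^'n" where
  "nabla2 g X Y Z x = nabla g X (nabla g Y Z) x - nabla g (nabla g X Y) Z x"

definition curvature ::
  "'n::finite matrix_field \<Rightarrow> real^'n \<Rightarrow> real^'n \<Rightarrow> real^'n \<Rightarrow> real^'n \<Rightarrow> real^'n" where
  "curvature g x X Y Z = nabla2 g (\<lambda>_. X) (\<lambda>_. Y) (\<lambda>_. Z) x - nabla2 g (\<lambda>_. Y) (\<lambda>_. X) (\<lambda>_. Z) x"

definition orthonormal_frame :: "'n::finite matrix_field \<Rightarrow> real^'n \<Rightarrow> ('n \<Rightarrow> real^'n) \<Rightarrow> bool" where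
  "orthonormal_frame g x E \<longleftrightarrow> (\<forall>i j. metric g x (E i) (E j) = (if i = j then 1 else 0))"

(* The frame is only used for contractions at x, which do not depend on its choice. *)
definition frame :: "'n::finite matrix_field \<Rightarrow> real^'n \<Rightarrow> 'n \<Rightarrow> real^'n" where
  "frame g x = (SOME E. orthonormal_frame g x E)"

definition ricci :: "'n::finite matrix_field \<Rightarrow> real^'n \<Rightarrow> real^'n \<Rightarrow> real^'n" where
  "ricci g x X = (\<Sum>k\<in>UNIV. curvature g x X (frame g x k) (frame g x k))"

definition scalar_curvature :: "'n::finite matrix_field \<Rightarrow> real^'n \<Rightarrow> real" where
  "scalar_curvature g x = trace (matrix (ricci g x))"

(* The totally trace-free part of the curvature in dimension 4:
   the coefficients are 1/(n-2) = 1/2 and 1/((n-1)(n-2)) = 1/6. *)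
definition weyl :: "4 matrix_field \<Rightarrow> real^4 \<Rightarrow> real^4 \<Rightarrow> real^4 \<Rightarrow> real^4 \<Rightarrow> real^4" where
  "weyl g x X Y Z = curvature g x X Y Z
     - (1/2) *\<^sub>R (metric g x Y Z *\<^sub>R ricci g x X - metric g x X Z *\<^sub>R ricci g x Y
               + metric g x (ricci g x Y) Z *\<^sub>R X - metric g x (ricci g x X) Z *\<^sub>R Y)
     + (scalar_curvature g x / 6) *\<^sub>R (metric g x Y Z *\<^sub>R X - metric g x X Z *\<^sub>R Y)"

(* W(A) = W(A X_k, X_k) *)
definition weyl_op :: "4 matrix_field \<Rightarrow> real^4 \<Rightarrow> real^4^4 \<Rightarrow> real^4^4" where
  "weyl_op g x A = matrix (\<lambda>Z. \<Sum>k\<in>UNIV. weyl g x (A *v frame g x k) (frame g x k) Z)"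


section \<open>Two-forms and self-duality\<close>

definition skew :: "'n::finite matrix_field \<Rightarrow> real^'n \<Rightarrow> real^'n^'n \<Rightarrow> bool" where
  "skew g x A \<longleftrightarrow> (\<forall>X Y. metric g x (A *v X) Y = - metric g x X (A *v Y))"

definition form_of :: "'n::finite matrix_field \<Rightarrow> real^'n \<Rightarrow> real^'n^'n \<Rightarrow> real^'n \<Rightarrow> real^'n \<Rightarrow> real" where
  "form_of g x A X Y = metric g x (A *v X) Y"

(* Sum over (2,2)-shuffles, so that (e1 \<and> e2) \<and> (e3 \<and> e4) takes the value 1 on the dual frame. *)
definition wedge22 :: "('v \<Rightarrow> 'v \<Rightarrow> real) \<Rightarrow> ('v \<Rightarrow> 'v \<Rightarrow> real) \<Rightarrow> 'v \<Rightarrow> 'v \<Rightarrow> 'v \<Rightarrow> 'v \<Rightarrow> real" where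
  "wedge22 \<alpha> \<beta> X Y Z T =
       \<alpha> X Y * \<beta> Z T - \<alpha> X Z * \<beta> Y T + \<alpha> X T * \<beta> Y Z
     + \<alpha> Y Z * \<beta> X T - \<alpha> Y T * \<beta> X Z + \<alpha> Z T * \<beta> X Y"

(* The induced inner product of 2-forms, sum over i < j of \<alpha>(X_i,X_j) \<beta>(X_i,X_j). *)
definition form_inner ::
  "'n::finite matrix_field \<Rightarrow> real^'n \<Rightarrow> (real^'n \<Rightarrow> real^'n \<Rightarrow> real) \<Rightarrow> (real^'n \<Rightarrow> real^'n \<Rightarrow> real) \<Rightarrow> real" where
  "form_inner g x \<alpha> \<beta> =
     (\<Sum>i\<in>UNIV. \<Sum>j\<in>UNIV. \<alpha> (frame g x i) (frame g x j) * \<beta> (frame g x i) (frame g x j)) / 2"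

definition fundamental_form :: "'n::finite matrix_field \<Rightarrow> 'n matrix_field \<Rightarrow> real^'n \<Rightarrow> real^'n \<Rightarrow> real^'n \<Rightarrow> real" where
  "fundamental_form g J x = form_of g x (J x)"

definition volume_form ::
  "4 matrix_field \<Rightarrow> 4 matrix_field \<Rightarrow> real^4 \<Rightarrow> real^4 \<Rightarrow> real^4 \<Rightarrow> real^4 \<Rightarrow> real^4 \<Rightarrow> real" where
  "volume_form g J x X Y Z T =
     wedge22 (fundamental_form g J x) (fundamental_form g J x) X Y Z T / 2"

(* \<Omega>_B is the Hodge dual of \<Omega>_A: \<gamma> \<and> \<Omega>_B = <\<gamma>, \<Omega>_A> \<omega> for every 2-form \<gamma> = \<Omega>_C. *)
definition hodge_dual :: "4 matrix_field \<Rightarrow> 4 matrix_field \<Rightarrow> real^4 \<Rightarrow> real^4^4 \<Rightarrow> real^4^4 \<Rightarrow> bool" where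
  "hodge_dual g J x A B \<longleftrightarrow>
     (\<forall>C. skew g x C \<longrightarrow> (\<forall>X Y Z T.
        wedge22 (form_of g x C) (form_of g x B) X Y Z T
          = form_inner g x (form_of g x C) (form_of g x A) * volume_form g J x X Y Z T))"

(* The fibre of the bundle of self-dual 2-forms, as skew-symmetric endomorphisms. *)
definition self_dual_space :: "4 matrix_field \<Rightarrow> 4 matrix_field \<Rightarrow> real^4 \<Rightarrow> (real^4^4) set" where
  "self_dual_space g J x = {A. skew g x A \<and> hodge_dual g J x A A}"

(* Trace of an endomorphism f of the finite-dimensional subspace V, using an arbitrary basis. *)
definition trace_on :: "'v::real_vector set \<Rightarrow> ('v \<Rightarrow> 'v) \<Rightarrow> real" where
  "trace_on V f = (let B = (SOME B. independent B \<and> span B = V) in \<Sum>b\<in>B. representation B (f b) b)"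

definition weyl_plus_norm_sq :: "4 matrix_field \<Rightarrow> 4 matrix_field \<Rightarrow> real^4 \<Rightarrow> real" where
  "weyl_plus_norm_sq g J x = trace_on (self_dual_space g J x) (weyl_op g x \<circ> weyl_op g x)"


section \<open>Almost Hermitian, almost Kaehler and Kaehler manifolds\<close>

definition almost_hermitian ::
  "'a topology \<Rightarrow> ('a, 'n::finite) chart set \<Rightarrow> ('a, 'n) tensor2 \<Rightarrow> ('a, 'n) tensor2 \<Rightarrow> bool" where
  "almost_hermitian M A g J \<longleftrightarrow>
     smooth_manifold M A \<and> riemannian_metric A g \<and> endomorphism_field A J \<and>
     (\<forall>c\<in>A. \<forall>x\<in>coords c. J c x ** J c x = - mat 1 \<and> skew (g c) x (J c x))"

(* Exterior derivative of a 2-form on constant vector fields, whose brackets vanish. *)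
definition ext_deriv2 ::
  "(real^'n::finite \<Rightarrow> real^'n \<Rightarrow> real^'n \<Rightarrow> real) \<Rightarrow> real^'n \<Rightarrow> real^'n \<Rightarrow> real^'n \<Rightarrow> real^'n \<Rightarrow> real" where
  "ext_deriv2 \<alpha> x X Y Z =
     dir_deriv (\<lambda>y. \<alpha> y Y Z) x X + dir_deriv (\<lambda>y. \<alpha> y Z X) x Y + dir_deriv (\<lambda>y. \<alpha> y X Y) x Z"

definition almost_kaehler ::
  "'a topology \<Rightarrow> ('a, 'n::finite) chart set \<Rightarrow> ('a, 'n) tensor2 \<Rightarrow> ('a, 'n) tensor2 \<Rightarrow> bool" where
  "almost_kaehler M A g J \<longleftrightarrow> almost_hermitian M A g J \<and>
     (\<forall>c\<in>A. \<forall>x\<in>coords c. \<forall>X Y Z. ext_deriv2 (fundamental_form (g c) (J c)) x X Y Z = 0)"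

(* (\<nabla>_X J) Y = \<nabla>_X (J Y) - J (\<nabla>_X Y) *)
definition nabla_endo ::
  "'n::finite matrix_field \<Rightarrow> 'n matrix_field \<Rightarrow> real^'n \<Rightarrow> real^'n \<Rightarrow> real^'n \<Rightarrow> real^'n" where
  "nabla_endo g J x X Y = nabla g (\<lambda>_. X) (\<lambda>y. J y *v Y) x - J x *v nabla g (\<lambda>_. X) (\<lambda>_. Y) x"

definition kaehler ::
  "'a topology \<Rightarrow> ('a, 'n::finite) chart set \<Rightarrow> ('a, 'n) tensor2 \<Rightarrow> ('a, 'n) tensor2 \<Rightarrow> bool" where
  "kaehler M A g J \<longleftrightarrow> almost_hermitian M A g J \<and>
     (\<forall>c\<in>A. \<forall>x\<in>coords c. \<forall>X Y. nabla_endo (g c) (J c) x X Y = 0)"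

end

theory Submission
  imports Defs
begin

text \<open>
  Being Kaehler and the equation for \<open>W\<^sub>+\<close> are both local conditions, so the proof takes place in a chart.
  Two facts are behind it, and both are pointwise.

  The first is a Bochner formula.  On an almost Kaehler manifold the form \<open>\<Omega>\<close> is closed, hence coclosed
  (\<open>T_divergence\<close>), and its length is constant.  The derivative of \<open>d\<Omega> = 0\<close>, contracted with \<open>J\<close>, therefore
  gives without any integration
  \<open>S\<^sup>* - S = |\<nabla>J|\<^sup>2 / 2\<close>, where \<open>S\<^sup>*\<close> is the contraction of the curvature with \<open>J\<close> (\<open>star_scalar_curvature\<close>).
  In the present normalisation the entry of \<open>W\<^sub>+\<close> at the unit vector along \<open>\<Omega>\<close> is \<open>S\<^sup>*/2 - S/6\<close>, which is
  \<open>S/3 + |\<nabla>J|\<^sup>2/4\<close> (\<open>weyl_form_T\<close>).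

  The second is linear algebra: \<open>W\<^sub>+\<close> is a symmetric trace-free endomorphism of a space of dimension three,
  so each of its diagonal entries \<open>w\<close> satisfies \<open>w\<^sup>2 \<le> 2/3 |W\<^sub>+|\<^sup>2\<close>.  If \<open>|W\<^sub>+|\<^sup>2 = S\<^sup>2/6\<close> and \<open>S \<ge> 0\<close>, the entry at
  \<open>\<Omega>\<close> is therefore at most \<open>S/3\<close>, and \<open>\<nabla>J = 0\<close> (\<open>T_zero_of_weyl\<close>).  Conversely, if \<open>\<nabla>J = 0\<close>, the curvature
  commutes with \<open>J\<close>, which forces \<open>W\<^sub>+\<close> to be diagonal with entries \<open>S/3\<close>, \<open>-S/6\<close>, \<open>-S/6\<close>, and
  \<open>|W\<^sub>+|\<^sup>2 = S\<^sup>2/6\<close> (\<open>weyl_of_T_zero\<close>).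

  Throughout, tensors are evaluated on fields with constant coefficients in the chart: \<open>N V f\<close> is
  \<open>\<nabla>\<^sub>V f\<close>, \<open>T x X Y\<close> is \<open>(\<nabla>\<^sub>X J) Y\<close> and \<open>T2 x V X Y\<close> is \<open>(\<nabla>\<^sup>2\<^bsub>V,X\<^esub> J) Y\<close>.
\<close>


section \<open>Directional derivatives\<close>

lemma dir_deriv_eq: "(f has_derivative f') (at x) \<Longrightarrow> dir_deriv f x X = f' X"
  unfolding dir_deriv_def by (metis frechet_derivative_at)

lemma has_dir_deriv:
  "f differentiable (at x) \<Longrightarrow> (f has_derivative dir_deriv f x) (at x)"
  unfolding dir_deriv_def[abs_def] using frechet_derivative_works by blast

lemma linear_dir_deriv: "f differentiable (at x) \<Longrightarrow> linear (dir_deriv f x)"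
  using has_dir_deriv has_derivative_linear by blast

lemma dir_deriv_const [simp]: "dir_deriv (\<lambda>_. c) x X = 0"
  using dir_deriv_eq[OF has_derivative_const] .

lemma dir_deriv_cong:
  assumes "open U" "x \<in> U" "\<And>y. y \<in> U \<Longrightarrow> f y = h y"
  shows "dir_deriv f x X = dir_deriv h x X"
proof -
  have "(f has_derivative d) (at x) \<longleftrightarrow> (h has_derivative d) (at x)" for d
    using has_derivative_transform_within_open[OF _ assms(1,2), of f d UNIV h]
      has_derivative_transform_within_open[OF _ assms(1,2), of h d UNIV f] assms(3) by auto
  then show ?thesis
    unfolding dir_deriv_def frechet_derivative_def by simp
qed

lemma differentiable_cong:
  assumes "open U" "x \<in> U" "\<And>y. y \<in> U \<Longrightarrow> f y = h y" "h differentiable (at x)"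
  shows "f differentiable (at x)"
  using assms has_derivative_transform_within_open[of h _ x UNIV U f]
  unfolding differentiable_def by metis

lemma dir_deriv_bounded_linear:
  assumes "bounded_linear L" "f differentiable (at x)"
  shows "dir_deriv (\<lambda>y. L (f y)) x X = L (dir_deriv f x X)"
    and "(\<lambda>y. L (f y)) differentiable (at x)"
  using bounded_linear.has_derivative[OF assms(1) has_dir_deriv[OF assms(2)]]
  by (auto intro: dir_deriv_eq differentiableI)

lemma dir_deriv_add:
  assumes "f differentiable (at x)" "h differentiable (at x)"
  shows "dir_deriv (\<lambda>y. f y + h y) x X = dir_deriv f x X + dir_deriv h x X"
  by (rule dir_deriv_eq[OF has_derivative_add]) (auto intro: has_dir_deriv assms)

lemma dir_deriv_diff:
  assumes "f differentiable (at x)" "h differentiable (at x)"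
  shows "dir_deriv (\<lambda>y. f y - h y) x X = dir_deriv f x X - dir_deriv h x X"
  by (rule dir_deriv_eq[OF has_derivative_diff]) (auto intro: has_dir_deriv assms)

text \<open>The product rule for a field of linear maps applied to a vector field.  Since the source is
  finite-dimensional, it is enough to know the derivative of the field of maps on each fixed vector,
  so no topology on the space of linear maps enters.\<close>

lemma leibniz_linear:
  fixes F :: "real^'m::finite \<Rightarrow> real^'n::finite \<Rightarrow> 'c::real_normed_vector" and f :: "real^'m \<Rightarrow> real^'n"
  assumes U: "open U" "x \<in> U" and lin: "\<And>y. y \<in> U \<Longrightarrow> linear (F y)"
    and F: "\<And>Z. (\<lambda>y. F y Z) differentiable (at x)" and f: "f differentiable (at x)"
  shows "(\<lambda>y. F y (f y)) differentiable (at x)"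
    and "dir_deriv (\<lambda>y. F y (f y)) x X = dir_deriv (\<lambda>y. F y (f x)) x X + F x (dir_deriv f x X)"
proof -
  have expand: "F y Z = (\<Sum>i\<in>UNIV. (Z $ i) *\<^sub>R F y (axis i 1))" if "y \<in> U" for y Z
  proof -
    have "F y Z = F y (\<Sum>i\<in>UNIV. (Z $ i) *\<^sub>R axis i 1)"
      by (simp add: basis_expansion flip: scalar_mult_eq_scaleR)
    then show ?thesis
      by (simp add: linear_sum[OF lin[OF that]] linear_scale[OF lin[OF that]])
  qed
  let ?d = "\<lambda>X. \<Sum>i\<in>UNIV. (f x $ i) *\<^sub>R dir_deriv (\<lambda>y. F y (axis i 1)) x X
                 + (dir_deriv f x X $ i) *\<^sub>R F x (axis i 1)"
  let ?h = "\<lambda>y. \<Sum>i\<in>UNIV. (f y $ i) *\<^sub>R F y (axis i 1)"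
  have comp: "((\<lambda>y. f y $ i) has_derivative (\<lambda>X. dir_deriv f x X $ i)) (at x)" for i
    by (rule bounded_linear.has_derivative[OF bounded_linear_vec_nth has_dir_deriv[OF f]])
  have "(?h has_derivative ?d) (at x)"
    by (intro has_derivative_sum has_derivative_scaleR comp has_dir_deriv F)
  then have D: "((\<lambda>y. F y (f y)) has_derivative ?d) (at x)"
    by (rule has_derivative_transform_within_open[OF _ U]) (rule expand[symmetric])
  then show "(\<lambda>y. F y (f y)) differentiable (at x)" by (rule differentiableI)
  let ?d0 = "\<lambda>X. \<Sum>i\<in>UNIV. (f x $ i) *\<^sub>R dir_deriv (\<lambda>y. F y (axis i 1)) x X"
  have "((\<lambda>y. \<Sum>i\<in>UNIV. (f x $ i) *\<^sub>R F y (axis i 1)) has_derivative ?d0) (at x)"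
    by (intro has_derivative_sum bounded_linear.has_derivative[OF bounded_linear_scaleR_right]
        has_dir_deriv F)
  then have D0: "((\<lambda>y. F y (f x)) has_derivative ?d0) (at x)"
    by (rule has_derivative_transform_within_open[OF _ U]) (rule expand[symmetric])
  show "dir_deriv (\<lambda>y. F y (f y)) x X = dir_deriv (\<lambda>y. F y (f x)) x X + F x (dir_deriv f x X)"
    by (simp add: dir_deriv_eq[OF D] dir_deriv_eq[OF D0] expand[OF U(2), of "dir_deriv f x X"]
        sum.distrib)
qed

text \<open>The second difference of \<open>f\<close> over a small parallelogram with sides \<open>hX\<close> and \<open>hY\<close> is
  \<open>h\<^sup>2 \<partial>\<^sub>Y \<partial>\<^sub>X f\<close> up to \<open>o(h\<^sup>2)\<close>, by the mean value theorem along \<open>X\<close>.  The second difference is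
  symmetric in \<open>X\<close> and \<open>Y\<close>, which yields the symmetry of second derivatives below.\<close>

lemma second_difference_estimate:
  fixes f :: "real^'n::finite \<Rightarrow> real"
  assumes U: "open U" "x \<in> U" and f: "\<And>y. y \<in> U \<Longrightarrow> f differentiable (at y)"
    and p: "(\<lambda>y. dir_deriv f y X) differentiable (at x)" and e: "0 < e"
  shows "\<exists>d>0. \<forall>h. 0 < h \<and> h < d \<longrightarrow>
    \<bar>f (x + h *\<^sub>R X + h *\<^sub>R Y) - f (x + h *\<^sub>R X) - f (x + h *\<^sub>R Y) + f x
      - h\<^sup>2 * dir_deriv (\<lambda>y. dir_deriv f y X) x Y\<bar> \<le> e * h\<^sup>2"
proof -
  define q where "q y = dir_deriv f y X" for y
  define q' where "q' = dir_deriv q x"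
  define N where "N = norm X + norm Y + 1"
  have N: "0 < N" unfolding N_def by (smt (verit) norm_ge_zero)
  have q: "(q has_derivative q') (at x)"
    unfolding q'_def q_def[abs_def] by (rule has_dir_deriv[OF p])
  interpret q': bounded_linear q' using q has_derivative_bounded_linear by blast
  have "0 < e / (2 * N)" using e N by simp
  with q obtain d1 where d1: "0 < d1"
    "\<And>y. norm (y - x) < d1 \<Longrightarrow> norm (q y - q x - q' (y - x)) \<le> e / (2 * N) * norm (y - x)"
    unfolding has_derivative_at_alt by blast
  obtain d2 where d2: "0 < d2" "ball x d2 \<subseteq> U"
    using U by (meson openE)
  have "\<bar>f (x + h *\<^sub>R X + h *\<^sub>R Y) - f (x + h *\<^sub>R X) - f (x + h *\<^sub>R Y) + f x - h\<^sup>2 * q' Y\<bar> \<le> e * h\<^sup>2"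
    if h: "0 < h" "h < min d1 d2 / N" for h
  proof -
    have hN: "h * N < d1" "h * N < d2" using h N by (auto simp: pos_less_divide_eq)
    have small: "norm (t *\<^sub>R X + s *\<^sub>R Y) \<le> h * N" if "0 \<le> t" "t \<le> h" "0 \<le> s" "s \<le> h" for t s
    proof -
      have "norm (t *\<^sub>R X + s *\<^sub>R Y) \<le> t * norm X + s * norm Y"
        using norm_triangle_ineq[of "t *\<^sub>R X" "s *\<^sub>R Y"] that by simp
      also have "\<dots> \<le> h * norm X + h * norm Y"
        using that by (intro add_mono mult_right_mono) auto
      also have "\<dots> \<le> h * N" using h unfolding N_def by (simp add: algebra_simps)
      finally show ?thesis .
    qed
    have inU: "x + t *\<^sub>R X + s *\<^sub>R Y \<in> U" if "0 \<le> t" "t \<le> h" "0 \<le> s" "s \<le> h" for t s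
    proof -
      have "x + t *\<^sub>R X + s *\<^sub>R Y \<in> ball x d2"
        using small[OF that] hN norm_minus_commute[of x "x + (t *\<^sub>R X + s *\<^sub>R Y)"]
        by (simp add: dist_norm add.assoc)
      then show ?thesis using d2 by blast
    qed
    define \<phi> where "\<phi> t = f (x + t *\<^sub>R X + h *\<^sub>R Y) - f (x + t *\<^sub>R X + 0 *\<^sub>R Y)" for t
    have line: "((\<lambda>t. f (x + t *\<^sub>R X + s *\<^sub>R Y)) has_real_derivative q (x + t *\<^sub>R X + s *\<^sub>R Y)) (at t)"
      if "0 \<le> t" "t \<le> h" "0 \<le> s" "s \<le> h" for t s
    proof -
      have "((\<lambda>t. x + t *\<^sub>R X + s *\<^sub>R Y) has_derivative (\<lambda>u. u *\<^sub>R X)) (at t)"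
        by (auto intro!: derivative_eq_intros)
      from has_derivative_compose[OF this has_dir_deriv[OF f[OF inU[OF that]]]]
      have "((\<lambda>t. f (x + t *\<^sub>R X + s *\<^sub>R Y)) has_derivative
          (\<lambda>u. dir_deriv f (x + t *\<^sub>R X + s *\<^sub>R Y) (u *\<^sub>R X))) (at t)" .
      then show ?thesis
        unfolding has_field_derivative_def q_def
        by (simp add: linear_scale[OF linear_dir_deriv[OF f[OF inU[OF that]]]] mult_commute_abs)
    qed
    have "(\<phi> has_real_derivative (q (x + t *\<^sub>R X + h *\<^sub>R Y) - q (x + t *\<^sub>R X + 0 *\<^sub>R Y))) (at t)"
      if "0 \<le> t" "t \<le> h" for t
      unfolding \<phi>_def using that h by (intro DERIV_diff line) auto
    from MVT2[OF h(1) this] obtain t where t: "0 < t" "t < h"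
      and mvt: "\<phi> h - \<phi> 0 = (h - 0) * (q (x + t *\<^sub>R X + h *\<^sub>R Y) - q (x + t *\<^sub>R X + 0 *\<^sub>R Y))"
      by blast
    have est: "\<bar>q (x + t *\<^sub>R X + s *\<^sub>R Y) - q x - q' (t *\<^sub>R X + s *\<^sub>R Y)\<bar> \<le> e / 2 * h"
      if s: "0 \<le> s" "s \<le> h" for s
    proof -
      have sm: "norm (t *\<^sub>R X + s *\<^sub>R Y) \<le> h * N" using small t s by simp
      have "\<bar>q (x + t *\<^sub>R X + s *\<^sub>R Y) - q x - q' (t *\<^sub>R X + s *\<^sub>R Y)\<bar>
          \<le> e / (2 * N) * norm (t *\<^sub>R X + s *\<^sub>R Y)"
        using d1(2)[of "x + t *\<^sub>R X + s *\<^sub>R Y"] sm hN by (simp add: add.assoc)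
      also have "\<dots> \<le> e / (2 * N) * (h * N)"
        using sm e N by (intro mult_left_mono) auto
      also have "\<dots> = e / 2 * h" using N by simp
      finally show ?thesis .
    qed
    have "q' (t *\<^sub>R X + h *\<^sub>R Y) - q' (t *\<^sub>R X + 0 *\<^sub>R Y) = h * q' Y"
      by (simp add: q'.add q'.scaleR)
    then have "\<bar>(q (x + t *\<^sub>R X + h *\<^sub>R Y) - q (x + t *\<^sub>R X + 0 *\<^sub>R Y)) - h * q' Y\<bar> \<le> e * h"
      using est[of h] est[of 0] h t by linarith
    then have "h * \<bar>(q (x + t *\<^sub>R X + h *\<^sub>R Y) - q (x + t *\<^sub>R X + 0 *\<^sub>R Y)) - h * q' Y\<bar> \<le> h * (e * h)"
      using h by (intro mult_left_mono) auto
    moreover have "\<bar>\<phi> h - \<phi> 0 - h\<^sup>2 * q' Y\<bar>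
        = h * \<bar>(q (x + t *\<^sub>R X + h *\<^sub>R Y) - q (x + t *\<^sub>R X + 0 *\<^sub>R Y)) - h * q' Y\<bar>"
    proof -
      have "\<phi> h - \<phi> 0 - h\<^sup>2 * q' Y
        = h * ((q (x + t *\<^sub>R X + h *\<^sub>R Y) - q (x + t *\<^sub>R X + 0 *\<^sub>R Y)) - h * q' Y)"
        unfolding mvt by (simp add: power2_eq_square algebra_simps)
      then show ?thesis using h by (simp add: abs_mult)
    qed
    ultimately have "\<bar>\<phi> h - \<phi> 0 - h\<^sup>2 * q' Y\<bar> \<le> e * h\<^sup>2"
      by (simp add: power2_eq_square mult.left_commute)
    then show ?thesis unfolding \<phi>_def by (simp add: algebra_simps)
  qed
  moreover have "0 < min d1 d2 / N" using d1 d2 N by simp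
  ultimately show ?thesis unfolding q'_def q_def[abs_def] by blast
qed

lemma second_derivative_symmetric_real:
  fixes f :: "real^'n::finite \<Rightarrow> real"
  assumes U: "open U" "x \<in> U" and f: "\<And>y. y \<in> U \<Longrightarrow> f differentiable (at y)"
    and p: "\<And>X. (\<lambda>y. dir_deriv f y X) differentiable (at x)"
  shows "dir_deriv (\<lambda>y. dir_deriv f y X) x Y = dir_deriv (\<lambda>y. dir_deriv f y Y) x X"
    (is "?a = ?b")
proof -
  have "\<bar>?a - ?b\<bar> \<le> 0 + e" if e: "0 < e" for e
  proof -
    have e2: "0 < e / 2" using e by simp
    obtain d1 where d1: "d1 > 0" "\<And>h. 0 < h \<Longrightarrow> h < d1 \<Longrightarrow>
      \<bar>f (x + h *\<^sub>R X + h *\<^sub>R Y) - f (x + h *\<^sub>R X) - f (x + h *\<^sub>R Y) + f x - h\<^sup>2 * ?a\<bar> \<le> e / 2 * h\<^sup>2"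
      using second_difference_estimate[OF U f p e2, of X Y] by blast
    obtain d2 where d2: "d2 > 0" "\<And>h. 0 < h \<Longrightarrow> h < d2 \<Longrightarrow>
      \<bar>f (x + h *\<^sub>R Y + h *\<^sub>R X) - f (x + h *\<^sub>R Y) - f (x + h *\<^sub>R X) + f x - h\<^sup>2 * ?b\<bar> \<le> e / 2 * h\<^sup>2"
      using second_difference_estimate[OF U f p e2, of Y X] by blast
    define h where "h = min d1 d2 / 2"
    have h: "0 < h" "h < d1" "h < d2" using d1 d2 unfolding h_def by auto
    have comm: "x + h *\<^sub>R Y + h *\<^sub>R X = x + h *\<^sub>R X + h *\<^sub>R Y" by simp
    have "\<bar>h\<^sup>2 * ?a - h\<^sup>2 * ?b\<bar> \<le> e / 2 * h\<^sup>2 + e / 2 * h\<^sup>2"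
      using d1(2)[OF h(1,2)] d2(2)[OF h(1,3)] unfolding comm by linarith
    moreover have "\<bar>h\<^sup>2 * ?a - h\<^sup>2 * ?b\<bar> = h\<^sup>2 * \<bar>?a - ?b\<bar>"
      by (simp add: abs_mult flip: right_diff_distrib)
    ultimately have "h\<^sup>2 * \<bar>?a - ?b\<bar> \<le> h\<^sup>2 * e" by (simp add: mult.commute)
    then show ?thesis using h by simp
  qed
  then have "\<bar>?a - ?b\<bar> \<le> 0" by (rule field_le_epsilon)
  then show ?thesis by simp
qed

lemma second_derivative_symmetric:
  fixes f :: "real^'n::finite \<Rightarrow> 'b::euclidean_space"
  assumes U: "open U" "x \<in> U" and f: "\<And>y. y \<in> U \<Longrightarrow> f differentiable (at y)"
    and p: "\<And>X. (\<lambda>y. dir_deriv f y X) differentiable (at x)"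
  shows "dir_deriv (\<lambda>y. dir_deriv f y X) x Y = dir_deriv (\<lambda>y. dir_deriv f y Y) x X"
proof (rule euclidean_eqI)
  fix b :: 'b
  have L: "bounded_linear (\<lambda>v. v \<bullet> b)" by (rule bounded_linear_inner_left)
  have comp: "dir_deriv (\<lambda>z. f z \<bullet> b) y V = dir_deriv f y V \<bullet> b" if "y \<in> U" for y V
    by (rule dir_deriv_bounded_linear(1)[OF L f[OF that]])
  have comp2: "dir_deriv (\<lambda>y. dir_deriv (\<lambda>z. f z \<bullet> b) y V) x W
      = dir_deriv (\<lambda>y. dir_deriv f y V) x W \<bullet> b" for V W
    using dir_deriv_cong[OF U, of "\<lambda>y. dir_deriv (\<lambda>z. f z \<bullet> b) y V", OF comp]
    by (simp add: dir_deriv_bounded_linear(1)[OF L p])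
  have "dir_deriv (\<lambda>y. dir_deriv (\<lambda>z. f z \<bullet> b) y X) x Y = dir_deriv (\<lambda>y. dir_deriv (\<lambda>z. f z \<bullet> b) y Y) x X"
  proof (rule second_derivative_symmetric_real[OF U])
    show "(\<lambda>z. f z \<bullet> b) differentiable (at y)" if "y \<in> U" for y
      by (rule dir_deriv_bounded_linear(2)[OF L f[OF that]])
    show "(\<lambda>y. dir_deriv (\<lambda>z. f z \<bullet> b) y V) differentiable (at x)" for V
      by (rule differentiable_cong[OF U comp]) (auto intro: dir_deriv_bounded_linear(2)[OF L p])
  qed
  then show "dir_deriv (\<lambda>y. dir_deriv f y X) x Y \<bullet> b = dir_deriv (\<lambda>y. dir_deriv f y Y) x X \<bullet> b"
    by (simp add: comp2)
qed

text \<open>Two derivatives are what the proof uses: the curvature involves second derivatives of \<open>g\<close>, and the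
  Ricci identity for \<open>J\<close> second derivatives of \<open>J\<close>.\<close>

definition C2_on :: "(real^'n::finite) set \<Rightarrow> (real^'n \<Rightarrow> 'b::real_normed_vector) \<Rightarrow> bool" where
  "C2_on U f \<longleftrightarrow> (\<forall>x\<in>U. f differentiable (at x) \<and> (\<forall>X. (\<lambda>y. dir_deriv f y X) differentiable (at x)))"

lemma smooth_on_C2_on:
  fixes f :: "real^'n::finite \<Rightarrow> 'b::real_normed_vector"
  assumes "open U" "smooth_on U f"
  shows "C2_on U f"
  unfolding C2_on_def
proof (intro ballI conjI allI)
  fix x X assume x: "x \<in> U"
  have "Ck_on (Suc (Suc 0)) U f" using assms(2) unfolding smooth_on_def by blast
  then have D: "f differentiable_on U"
    and D2: "\<And>i. (\<lambda>x. frechet_derivative f (at x) (axis i 1)) differentiable_on U" by auto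
  have f: "f differentiable (at y)" if "y \<in> U" for y
    using D that assms(1) by (simp add: differentiable_on_eq_differentiable_at)
  then show "f differentiable (at x)" using x .
  have f2: "(\<lambda>y. dir_deriv f y (axis i 1)) differentiable (at x)" for i
    using D2 x assms(1) unfolding dir_deriv_def by (simp add: differentiable_on_eq_differentiable_at)
  have "(\<lambda>y. \<Sum>i\<in>UNIV. (X $ i) *\<^sub>R dir_deriv f y (axis i 1)) differentiable (at x)"
    using f2 by (intro differentiable_sum) (auto intro!: differentiable_scaleR)
  from _ this show "(\<lambda>y. dir_deriv f y X) differentiable (at x)"
  proof (rule differentiable_cong[OF assms(1) x])
    fix y assume "y \<in> U"
    then have l: "linear (dir_deriv f y)" using f linear_dir_deriv by blast
    have "dir_deriv f y X = dir_deriv f y (\<Sum>i\<in>UNIV. (X $ i) *\<^sub>R axis i 1)"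
      by (simp add: basis_expansion flip: scalar_mult_eq_scaleR)
    then show "dir_deriv f y X = (\<Sum>i\<in>UNIV. (X $ i) *\<^sub>R dir_deriv f y (axis i 1))"
      by (simp add: linear_sum[OF l] linear_scale[OF l])
  qed
qed

lemma C2_on_bounded_linear:
  assumes "open U" "bounded_linear L" "C2_on U f"
  shows "C2_on U (\<lambda>y. L (f y))"
  unfolding C2_on_def
proof (intro ballI conjI allI)
  fix x X assume x: "x \<in> U"
  have f: "\<And>y. y \<in> U \<Longrightarrow> f differentiable (at y)"
    and f2: "\<And>X. (\<lambda>y. dir_deriv f y X) differentiable (at x)"
    using assms(3) x unfolding C2_on_def by auto
  show "(\<lambda>y. L (f y)) differentiable (at x)"
    by (rule dir_deriv_bounded_linear(2)[OF assms(2) f[OF x]])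
  show "(\<lambda>y. dir_deriv (\<lambda>y. L (f y)) y X) differentiable (at x)"
    by (rule differentiable_cong[OF assms(1) x dir_deriv_bounded_linear(1)[OF assms(2) f]])
      (auto intro: dir_deriv_bounded_linear(2)[OF assms(2) f2])
qed


section \<open>The Levi-Civita connection in a chart\<close>

lemma metric_linear_left: "linear (\<lambda>X. metric g x X Y)"
  by (rule linearI) (simp_all add: metric_def inner_simps)

lemma metric_linear_right: "linear (metric g x X)"
  by (rule linearI) (simp_all add: metric_def inner_simps algebra_simps)

lemmas metric_simps =
  linear_add[OF metric_linear_left] linear_add[OF metric_linear_right]
  linear_diff[OF metric_linear_left] linear_diff[OF metric_linear_right]
  linear_neg[OF metric_linear_left] linear_neg[OF metric_linear_right]
  linear_scale[OF metric_linear_left, simplified] linear_scale[OF metric_linear_right, simplified]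
  linear_0[OF metric_linear_left] linear_0[OF metric_linear_right]

lemma bounded_linear_metric_entry:
  "bounded_linear (\<lambda>A. X \<bullet> (A *v Y))" for X :: "real^'n::finite" and Y :: "real^'n"
proof -
  have "linear (\<lambda>A. X \<bullet> (A *v Y))"
    by (rule linearI)
      (simp_all add: algebra_simps inner_simps matrix_vector_mult_add_rdistrib scaleR_matrix_vector_assoc[symmetric])
  then show ?thesis by (simp add: linear_conv_bounded_linear)
qed

lemma bounded_linear_matrix_apply:
  "bounded_linear (\<lambda>A. A *v Y)" for Y :: "real^'n::finite"
proof -
  have "linear (\<lambda>A. A *v Y :: real^'m::finite)"
    by (rule linearI)
      (simp_all add: algebra_simps matrix_vector_mult_add_rdistrib scaleR_matrix_vector_assoc[symmetric])
  then show ?thesis by (simp add: linear_conv_bounded_linear)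
qed

lemma linear_eq_sum_axis:
  fixes \<phi> :: "real^'n::finite \<Rightarrow> real"
  assumes "linear \<phi>"
  shows "\<phi> Z = (\<Sum>k\<in>UNIV. Z $ k * \<phi> (axis k 1))"
proof -
  have "\<phi> Z = \<phi> (\<Sum>i\<in>UNIV. (Z $ i) *\<^sub>R axis i 1)"
    by (simp add: basis_expansion flip: scalar_mult_eq_scaleR)
  then show ?thesis by (simp add: linear_sum[OF assms] linear_scale[OF assms])
qed

lemma differentiable_componentwise_vec:
  fixes v :: "real^'m::finite \<Rightarrow> real^'n::finite"
  assumes "\<And>k. (\<lambda>y. v y $ k) differentiable (at x)"
  shows "v differentiable (at x)"
proof -
  have "(\<lambda>y. \<Sum>i\<in>UNIV. (v y $ i) *\<^sub>R axis i (1::real)) differentiable (at x)"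
    using assms by (intro differentiable_sum) (auto intro!: differentiable_scaleR)
  then show ?thesis
    by (simp add: basis_expansion flip: scalar_mult_eq_scaleR)
qed

lemma det_differentiable:
  fixes A :: "real^'m::finite \<Rightarrow> real^'n::finite^'n"
  assumes "\<And>i j. (\<lambda>y. A y $ i $ j) differentiable (at x)"
  shows "(\<lambda>y. det (A y)) differentiable (at x)"
proof -
  have "(\<lambda>y. \<Prod>i\<in>UNIV. A y $ i $ p i) differentiable (at x)" for p
    by (rule differentiableI[OF has_derivative_prod[OF has_dir_deriv[OF assms]]])
  then show ?thesis
    unfolding det_def by (intro differentiable_sum) (auto intro!: differentiable_mult)
qed

locale riemann_chart =
  fixes U :: "(real^'n::finite) set" and g :: "'n matrix_field"
  assumes open_U: "open U" and C2_g: "C2_on U g"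
    and metric_sym: "\<And>x X Y. x \<in> U \<Longrightarrow> metric g x X Y = metric g x Y X"
    and metric_pos: "\<And>x X. x \<in> U \<Longrightarrow> X \<noteq> 0 \<Longrightarrow> 0 < metric g x X X"
begin

abbreviation N :: "real^'n \<Rightarrow> (real^'n \<Rightarrow> real^'n) \<Rightarrow> real^'n \<Rightarrow> real^'n" where
  "N V \<equiv> nabla g (\<lambda>_. V)"

abbreviation \<Gamma> :: "real^'n \<Rightarrow> real^'n \<Rightarrow> real^'n \<Rightarrow> real^'n" where
  "\<Gamma> \<equiv> christoffel g"

lemma metric_eqI:
  assumes "x \<in> U" "\<And>Z. metric g x V Z = metric g x W Z"
  shows "V = W"
proof (rule ccontr)
  assume "V \<noteq> W"
  then have "0 < metric g x (V - W) (V - W)" using metric_pos[OF assms(1)] by simp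
  then show False using assms(2)[of "V - W"] by (simp add: metric_simps)
qed

lemma g_differentiable: "x \<in> U \<Longrightarrow> g differentiable (at x)"
  using C2_g unfolding C2_on_def by blast

lemma C2_metric: "C2_on U (\<lambda>y. metric g y X Y)"
  unfolding metric_def by (rule C2_on_bounded_linear[OF open_U bounded_linear_metric_entry C2_g])

lemma metric_differentiable: "x \<in> U \<Longrightarrow> (\<lambda>y. metric g y X Y) differentiable (at x)"
  using C2_metric unfolding C2_on_def by blast

definition metric_deriv :: "real^'n \<Rightarrow> real^'n \<Rightarrow> real^'n \<Rightarrow> real^'n \<Rightarrow> real" where
  "metric_deriv x V X Y = dir_deriv (\<lambda>y. metric g y X Y) x V"

lemma metric_deriv_eq:
  "x \<in> U \<Longrightarrow> metric_deriv x V X Y = metric (\<lambda>y. dir_deriv g y V) x X Y"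
  unfolding metric_deriv_def metric_def
  by (rule dir_deriv_bounded_linear(1)[OF bounded_linear_metric_entry g_differentiable])

lemma metric_deriv_linear:
  assumes "x \<in> U"
  shows "linear (\<lambda>V. metric_deriv x V X Y)" "linear (\<lambda>X. metric_deriv x V X Y)"
    "linear (\<lambda>Y. metric_deriv x V X Y)"
proof -
  show "linear (\<lambda>V. metric_deriv x V X Y)"
    unfolding metric_deriv_def by (rule linear_dir_deriv[OF metric_differentiable[OF assms]])
  show "linear (\<lambda>X. metric_deriv x V X Y)" "linear (\<lambda>Y. metric_deriv x V X Y)"
    unfolding metric_deriv_eq[OF assms] by (rule metric_linear_left metric_linear_right)+
qed

lemmas metric_deriv_simps = metric_deriv_linear[THEN linear_add] metric_deriv_linear[THEN linear_scale, simplified]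

lemma metric_deriv_sym: "x \<in> U \<Longrightarrow> metric_deriv x V X Y = metric_deriv x V Y X"
  unfolding metric_deriv_def by (rule dir_deriv_cong[OF open_U]) (auto simp: metric_sym)

lemma g_invertible: assumes "x \<in> U" shows "invertible (g x)"
proof -
  have "X = 0" if "g x *v X = 0" for X
    using metric_pos[OF assms, of X] that unfolding metric_def by auto
  then show ?thesis
    by (simp add: invertible_left_inverse matrix_left_invertible_ker)
qed

lemma g_matrix_inv: assumes "x \<in> U" shows "g x ** matrix_inv (g x) = mat 1"
  using someI_ex[OF g_invertible[OF assms, unfolded invertible_def]] unfolding matrix_inv_def
  by (rule conjunct1)

text \<open>Koszul's formula for vector fields with constant coefficients.  The Christoffel symbols are defined
  by solving it for \<open>Z\<close> in the coordinate basis; both sides being linear in \<open>Z\<close>, it holds in general.\<close>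

lemma metric_christoffel:
  assumes x: "x \<in> U"
  shows "metric g x (\<Gamma> x X Y) Z
    = (metric_deriv x X Y Z + metric_deriv x Y X Z - metric_deriv x Z X Y) / 2"
proof -
  define \<phi> where "\<phi> Z = (metric_deriv x X Y Z + metric_deriv x Y X Z - metric_deriv x Z X Y) / 2" for Z
  have lin: "linear \<phi>"
    by (rule linearI) (simp_all add: \<phi>_def metric_deriv_simps[OF x] field_simps)
  have "g x *v \<Gamma> x X Y = (\<chi> k. \<phi> (axis k 1))"
    unfolding christoffel_def \<phi>_def metric_deriv_def
    by (simp add: matrix_vector_mul_assoc g_matrix_inv[OF x])
  then have "metric g x Z (\<Gamma> x X Y) = (\<Sum>k\<in>UNIV. Z $ k * \<phi> (axis k 1))"
    unfolding metric_def by (simp add: inner_vec_def)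
  also have "\<dots> = \<phi> Z" by (rule linear_eq_sum_axis[OF lin, symmetric])
  finally show ?thesis using metric_sym[OF x, of Z] unfolding \<phi>_def by simp
qed

lemma christoffel_sym: "x \<in> U \<Longrightarrow> \<Gamma> x X Y = \<Gamma> x Y X"
  by (rule metric_eqI) (auto simp: metric_christoffel metric_deriv_sym[of x _ X Y])

lemma christoffel_linear_right: assumes x: "x \<in> U" shows "linear (\<Gamma> x X)"
  by (rule linearI; rule metric_eqI[OF x])
    (simp_all add: metric_christoffel[OF x] metric_simps metric_deriv_simps[OF x] field_simps)

lemma christoffel_linear_left: assumes x: "x \<in> U" shows "linear (\<lambda>X. \<Gamma> x X Y)"
  using christoffel_linear_right[OF x, of Y] unfolding christoffel_sym[OF x, of _ Y] .

lemmas christoffel_simps =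
  linear_add[OF christoffel_linear_right] linear_add[OF christoffel_linear_left]
  linear_diff[OF christoffel_linear_right] linear_diff[OF christoffel_linear_left]
  linear_scale[OF christoffel_linear_right] linear_scale[OF christoffel_linear_left]
  linear_neg[OF christoffel_linear_right] linear_neg[OF christoffel_linear_left]

text \<open>The Christoffel symbols solve a linear system with matrix \<open>g\<close>, so they are as regular as the
  first derivatives of \<open>g\<close> by Cramer's rule.\<close>

lemma christoffel_differentiable:
  assumes x: "x \<in> U" shows "(\<lambda>y. \<Gamma> y X Y) differentiable (at x)"
proof -
  define b :: "real^'n \<Rightarrow> real^'n" where "b y = (\<chi> k. (dir_deriv (\<lambda>y. metric g y Y (axis k 1)) y X
          + dir_deriv (\<lambda>y. metric g y X (axis k 1)) y Y
          - dir_deriv (\<lambda>y. metric g y X Y) y (axis k 1)) / 2)" for y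
  define cr :: "real^'n \<Rightarrow> real^'n" where
    "cr y = (\<chi> k. det (\<chi> i j. if j = k then b y $ i else g y $ i $ j) / det (g y))" for y
  have d: "det (g y) \<noteq> 0" if "y \<in> U" for y
    using g_invertible[OF that] by (simp add: invertible_det_nz)
  have eq: "\<Gamma> y X Y = cr y" if "y \<in> U" for y
  proof -
    have "g y *v \<Gamma> y X Y = b y"
      unfolding christoffel_def b_def by (simp add: matrix_vector_mul_assoc g_matrix_inv[OF that])
    then show ?thesis unfolding cramer[OF d[OF that]] cr_def .
  qed
  have ent: "(\<lambda>y. g y $ i $ j) differentiable (at x)" for i j
    using dir_deriv_bounded_linear(2)[OF bounded_linear_compose[OF bounded_linear_vec_nth bounded_linear_vec_nth]
      g_differentiable[OF x]] .
  have db: "(\<lambda>y. b y $ i) differentiable (at x)" for i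
    using C2_metric x unfolding b_def C2_on_def
    by (auto intro!: differentiable_add differentiable_diff differentiable_divide)
  have "(\<lambda>y. if j = k then b y $ i else g y $ i $ j) differentiable (at x)" for i j k
    by (cases "j = k") (auto intro: ent db)
  then have "(\<lambda>y. det (\<chi> i j. if j = k then b y $ i else g y $ i $ j)) differentiable (at x)" for k
    by (intro det_differentiable) simp
  moreover have "(\<lambda>y. det (g y)) differentiable (at x)"
    by (intro det_differentiable ent)
  ultimately have "(\<lambda>y. cr y $ k) differentiable (at x)" for k
    unfolding cr_def by (simp add: differentiable_divide d[OF x])
  then have "cr differentiable (at x)"
    by (rule differentiable_componentwise_vec)
  from differentiable_cong[OF open_U x eq this] show ?thesis .
qed

lemma N_const: "N V (\<lambda>_. X) = (\<lambda>y. \<Gamma> y V X)"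
  unfolding nabla_def by simp

lemma N_add:
  "f differentiable (at x) \<Longrightarrow> h differentiable (at x) \<Longrightarrow> x \<in> U \<Longrightarrow>
    N V (\<lambda>y. f y + h y) x = N V f x + N V h x"
  unfolding nabla_def by (simp add: dir_deriv_add christoffel_simps)

lemma N_diff:
  "f differentiable (at x) \<Longrightarrow> h differentiable (at x) \<Longrightarrow> x \<in> U \<Longrightarrow>
    N V (\<lambda>y. f y - h y) x = N V f x - N V h x"
  unfolding nabla_def by (simp add: dir_deriv_diff christoffel_simps)

lemma N_cong:
  "x \<in> U \<Longrightarrow> (\<And>y. y \<in> U \<Longrightarrow> f y = h y) \<Longrightarrow> N V f x = N V h x"
  unfolding nabla_def using dir_deriv_cong[OF open_U] by metis

lemma N_linear_direction:
  assumes "x \<in> U" "f differentiable (at x)"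
  shows "linear (\<lambda>V. N V f x)"
  unfolding nabla_def
  by (intro linear_compose_add linear_dir_deriv christoffel_linear_left assms)

lemma metric_fields_differentiable:
  assumes x: "x \<in> U" and f: "f differentiable (at x)" and h: "h differentiable (at x)"
  shows "(\<lambda>y. metric g y (f y) (h y)) differentiable (at x)"
proof -
  have "(\<lambda>y. metric g y Z (h y)) differentiable (at x)" for Z
    by (rule leibniz_linear(1)[OF open_U x metric_linear_right metric_differentiable[OF x] h])
  from leibniz_linear(1)[OF open_U x metric_linear_left this f] show ?thesis .
qed

text \<open>The symmetric half of Koszul's formula: on adding the expressions for \<open>g(\<Gamma>(V,f),h)\<close> and
  \<open>g(\<Gamma>(V,h),f)\<close>, only the derivative of \<open>g\<close> along \<open>V\<close> survives.\<close>

lemma metric_compatible: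
  assumes x: "x \<in> U" and f: "f differentiable (at x)" and h: "h differentiable (at x)"
  shows "dir_deriv (\<lambda>y. metric g y (f y) (h y)) x V
    = metric g x (N V f x) (h x) + metric g x (f x) (N V h x)"
proof -
  have 1: "(\<lambda>y. metric g y Z (h y)) differentiable (at x)" for Z
    by (rule leibniz_linear(1)[OF open_U x metric_linear_right metric_differentiable[OF x] h])
  have "dir_deriv (\<lambda>y. metric g y (f y) (h y)) x V
      = dir_deriv (\<lambda>y. metric g y (f x) (h x)) x V + metric g x (f x) (dir_deriv h x V)
        + metric g x (dir_deriv f x V) (h x)"
    unfolding leibniz_linear(2)[OF open_U x metric_linear_left 1 f]
      leibniz_linear(2)[OF open_U x metric_linear_right metric_differentiable[OF x] h] ..
  moreover have "metric g x (\<Gamma> x V (f x)) (h x) + metric g x (f x) (\<Gamma> x V (h x))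
      = metric_deriv x V (f x) (h x)"
    unfolding metric_sym[OF x, of "f x" "\<Gamma> x V (h x)"] metric_christoffel[OF x]
    using metric_deriv_sym[OF x, of V "f x" "h x"] by (simp add: field_simps)
  ultimately show ?thesis unfolding nabla_def metric_deriv_def by (simp add: metric_simps)
qed


section \<open>The curvature tensor\<close>

text \<open>The terms \<open>\<nabla>\<^bsub>\<nabla>\<^sub>V X\<^esub> Z\<close> in the two second derivatives agree because the connection is torsion-free.\<close>

lemma curvature_eq:
  assumes x: "x \<in> U"
  shows "curvature g x V X Z = N V (\<lambda>y. \<Gamma> y X Z) x - N X (\<lambda>y. \<Gamma> y V Z) x"
proof -
  have "nabla g (\<lambda>y. \<Gamma> y V X) (\<lambda>_. Z) x = nabla g (\<lambda>y. \<Gamma> y X V) (\<lambda>_. Z) x"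
    unfolding nabla_def by (simp add: christoffel_sym[OF x, of V X])
  then show ?thesis unfolding curvature_def nabla2_def N_const by simp
qed

lemma curvature_antisym: "curvature g x V X Z = - curvature g x X V Z"
  unfolding curvature_def by simp

lemma N_differentiable:
  assumes x: "x \<in> U" and f: "C2_on U f"
  shows "(\<lambda>y. N X f y) differentiable (at x)"
proof -
  have 1: "f differentiable (at x)" "(\<lambda>y. dir_deriv f y X) differentiable (at x)"
    using f x unfolding C2_on_def by auto
  have "(\<lambda>y. \<Gamma> y X (f y)) differentiable (at x)"
    by (rule leibniz_linear(1)[OF open_U x christoffel_linear_right christoffel_differentiable[OF x] 1(1)])
  then show ?thesis unfolding nabla_def by (intro differentiable_add 1)
qed

text \<open>The curvature is defined through fields with constant coefficients.  It acts in the same way on a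
  variable field \<open>f\<close>, since the second derivatives of \<open>f\<close> drop out by their symmetry.  This is needed for
  \<open>f = J Y\<close>.\<close>

lemma N_commutator:
  assumes x: "x \<in> U" and f: "C2_on U f"
  shows "N V (\<lambda>y. N X f y) x - N X (\<lambda>y. N V f y) x = curvature g x V X (f x)"
proof -
  have fd: "\<And>y. y \<in> U \<Longrightarrow> f differentiable (at y)"
    and fdd: "\<And>X. (\<lambda>y. dir_deriv f y X) differentiable (at x)"
    using f x unfolding C2_on_def by auto
  note leib = leibniz_linear[OF open_U x christoffel_linear_right christoffel_differentiable[OF x] fd[OF x]]
  have NN: "N V (\<lambda>y. N X f y) x = dir_deriv (\<lambda>y. dir_deriv f y X) x V
      + dir_deriv (\<lambda>y. \<Gamma> y X (f x)) x V + \<Gamma> x X (dir_deriv f x V) + \<Gamma> x V (dir_deriv f x X)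
      + \<Gamma> x V (\<Gamma> x X (f x))" for V X
    unfolding nabla_def
    by (simp add: dir_deriv_add[OF fdd leib(1)] leib(2) christoffel_simps[OF x])
  show ?thesis
    using second_derivative_symmetric[OF open_U x fd fdd, of X V]
    unfolding NN curvature_eq[OF x] unfolding nabla_def by (simp add: algebra_simps)
qed

text \<open>With \<open>\<nabla>\<^sub>X Z = \<nabla>\<^sub>Z X\<close> for constant coefficients, the six terms of the cyclic sum cancel in pairs.\<close>

lemma curvature_bianchi:
  assumes x: "x \<in> U"
  shows "curvature g x V X Z + curvature g x X Z V + curvature g x Z V X = 0"
proof -
  have "N V (\<lambda>y. \<Gamma> y X Z) x = N V (\<lambda>y. \<Gamma> y Z X) x" for V X Z
    by (rule N_cong[OF x christoffel_sym])
  from this[of V X Z] this[of X Z V] this[of Z V X] show ?thesis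
    unfolding curvature_eq[OF x] by simp
qed

text \<open>The curvature endomorphisms are skew because second derivatives of \<open>g(Y,Z)\<close> commute.\<close>

lemma curvature_skew:
  assumes x: "x \<in> U"
  shows "metric g x (curvature g x V X Y) Z = - metric g x Y (curvature g x V X Z)"
proof -
  have D: "dir_deriv (\<lambda>y. metric g y Y Z) y X = metric g y (\<Gamma> y X Y) Z + metric g y Y (\<Gamma> y X Z)"
    if "y \<in> U" for y X
    using metric_compatible[OF that, of "\<lambda>_. Y" "\<lambda>_. Z" X] by (simp add: N_const)
  note d = christoffel_differentiable[OF x] differentiable_const
  have DD: "dir_deriv (\<lambda>y. dir_deriv (\<lambda>y. metric g y Y Z) y X) x V
      = metric g x (N V (\<lambda>y. \<Gamma> y X Y) x) Z + metric g x (\<Gamma> x X Y) (\<Gamma> x V Z)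
        + metric g x (\<Gamma> x V Y) (\<Gamma> x X Z) + metric g x Y (N V (\<lambda>y. \<Gamma> y X Z) x)" for X V
  proof -
    have "dir_deriv (\<lambda>y. dir_deriv (\<lambda>y. metric g y Y Z) y X) x V
        = dir_deriv (\<lambda>y. metric g y (\<Gamma> y X Y) Z + metric g y Y (\<Gamma> y X Z)) x V"
      by (rule dir_deriv_cong[OF open_U x D])
    also have "\<dots> = dir_deriv (\<lambda>y. metric g y (\<Gamma> y X Y) Z) x V + dir_deriv (\<lambda>y. metric g y Y (\<Gamma> y X Z)) x V"
      by (intro dir_deriv_add metric_fields_differentiable x d)
    finally show ?thesis
      using metric_compatible[OF x d(1) d(2), of X Y Z V] metric_compatible[OF x d(2) d(1), of Y X Z V]
      by (simp add: N_const)
  qed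
  have "dir_deriv (\<lambda>y. dir_deriv (\<lambda>y. metric g y Y Z) y X) x V
      = dir_deriv (\<lambda>y. dir_deriv (\<lambda>y. metric g y Y Z) y V) x X"
    using C2_metric[of Y Z] x unfolding C2_on_def
    by (intro second_derivative_symmetric[OF open_U x]) auto
  then show ?thesis unfolding DD curvature_eq[OF x] by (simp add: metric_simps)
qed

lemma N_christoffel_linear:
  assumes x: "x \<in> U"
  shows "linear (\<lambda>V. N V (\<lambda>y. \<Gamma> y X Z) x)"
    and "linear (\<lambda>X. N V (\<lambda>y. \<Gamma> y X Z) x)"
proof -
  note d = christoffel_differentiable[OF x]
  show "linear (\<lambda>V. N V (\<lambda>y. \<Gamma> y X Z) x)"
    by (rule N_linear_direction[OF x d])
  show "linear (\<lambda>X. N V (\<lambda>y. \<Gamma> y X Z) x)"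
  proof (rule linearI)
    fix X X' and c :: real
    have "N V (\<lambda>y. \<Gamma> y (X + X') Z) x = N V (\<lambda>y. \<Gamma> y X Z + \<Gamma> y X' Z) x"
      by (rule N_cong[OF x]) (simp add: christoffel_simps)
    then show "N V (\<lambda>y. \<Gamma> y (X + X') Z) x = N V (\<lambda>y. \<Gamma> y X Z) x + N V (\<lambda>y. \<Gamma> y X' Z) x"
      by (simp add: N_add[OF d d x])
    have "N V (\<lambda>y. \<Gamma> y (c *\<^sub>R X) Z) x = N V (\<lambda>y. c *\<^sub>R \<Gamma> y X Z) x"
      by (rule N_cong[OF x]) (simp add: christoffel_simps)
    then show "N V (\<lambda>y. \<Gamma> y (c *\<^sub>R X) Z) x = c *\<^sub>R N V (\<lambda>y. \<Gamma> y X Z) x"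
      unfolding nabla_def
      by (simp add: dir_deriv_bounded_linear(1)[OF bounded_linear_scaleR_right d] christoffel_simps[OF x]
          scaleR_add_right)
  qed
qed

lemma curvature_linear_1: "x \<in> U \<Longrightarrow> linear (\<lambda>V. curvature g x V X Z)"
  unfolding curvature_eq by (intro linear_compose_sub N_christoffel_linear)

lemma curvature_linear_2: "x \<in> U \<Longrightarrow> linear (\<lambda>X. curvature g x V X Z)"
  unfolding curvature_eq by (intro linear_compose_sub N_christoffel_linear)

lemma curvature_linear_3: assumes x: "x \<in> U" shows "linear (\<lambda>Z. curvature g x V X Z)"
proof (rule linearI; rule metric_eqI[OF x])
  fix Y Z W and c :: real
  show "metric g x (curvature g x V X (Y + Z)) W = metric g x (curvature g x V X Y + curvature g x V X Z) W"
    by (simp add: curvature_skew[OF x, of V X _ W] metric_simps)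
  show "metric g x (curvature g x V X (c *\<^sub>R Y)) W = metric g x (c *\<^sub>R curvature g x V X Y) W"
    by (simp add: curvature_skew[OF x, of V X _ W] metric_simps)
qed

end


section \<open>The covariant derivatives of the almost complex structure\<close>

locale almost_kaehler_chart = riemann_chart U g
  for U :: "(real^'n::finite) set" and g :: "'n matrix_field" +
  fixes J :: "'n matrix_field"
  assumes C2_J: "C2_on U J"
    and J_J: "\<And>x X. x \<in> U \<Longrightarrow> J x *v (J x *v X) = - X"
    and J_skew: "\<And>x X Y. x \<in> U \<Longrightarrow> metric g x (J x *v X) Y = - metric g x X (J x *v Y)"
    and closed: "\<And>x X Y Z. x \<in> U \<Longrightarrow> ext_deriv2 (fundamental_form g J) x X Y Z = 0"
begin

abbreviation T :: "real^'n \<Rightarrow> real^'n \<Rightarrow> real^'n \<Rightarrow> real^'n" where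
  "T \<equiv> nabla_endo g J"

text \<open>The second covariant derivative \<open>(\<nabla>\<^sup>2\<^bsub>V,X\<^esub> J) Y\<close>: the fields \<open>X\<close> and \<open>Y\<close> with constant coefficients are not
  parallel, and the last two terms correct for their derivatives.\<close>

definition T2 :: "real^'n \<Rightarrow> real^'n \<Rightarrow> real^'n \<Rightarrow> real^'n \<Rightarrow> real^'n" where
  "T2 x V X Y = N V (\<lambda>y. T y X Y) x - T x (\<Gamma> x V X) Y - T x X (\<Gamma> x V Y)"

lemma J_isometry: "x \<in> U \<Longrightarrow> metric g x (J x *v X) (J x *v Y) = metric g x X Y"
  using J_skew[of x X "J x *v Y"] J_J[of x Y] by (simp add: metric_simps)

lemma J_linear: "linear ((*v) (J x))"
  by simp

lemma C2_J_apply: "C2_on U (\<lambda>y. J y *v Y)"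
  by (rule C2_on_bounded_linear[OF open_U bounded_linear_matrix_apply C2_J])

lemma J_differentiable: "x \<in> U \<Longrightarrow> (\<lambda>y. J y *v Y) differentiable (at x)"
  using C2_J_apply unfolding C2_on_def by blast

lemma J_field_differentiable:
  assumes "x \<in> U" "f differentiable (at x)"
  shows "(\<lambda>y. J y *v f y) differentiable (at x)"
  by (rule leibniz_linear(1)[OF open_U assms(1) J_linear J_differentiable[OF assms(1)] assms(2)])

lemma N_J:
  assumes x: "x \<in> U" and f: "f differentiable (at x)"
  shows "N X (\<lambda>y. J y *v f y) x = T x X (f x) + J x *v N X f x"
  unfolding nabla_endo_def nabla_def
    leibniz_linear(2)[OF open_U x J_linear J_differentiable[OF x] f]
  by (simp add: algebra_simps)

lemma T_eq: "T x X Y = N X (\<lambda>y. J y *v Y) x - J x *v \<Gamma> x X Y"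
  unfolding nabla_endo_def N_const ..

lemma T_differentiable: assumes x: "x \<in> U" shows "(\<lambda>y. T y X Y) differentiable (at x)"
  unfolding T_eq
  by (intro differentiable_diff N_differentiable C2_J_apply J_field_differentiable
      christoffel_differentiable x)

lemma T_linear_1: assumes x: "x \<in> U" shows "linear (\<lambda>X. T x X Y)"
proof -
  have "linear (\<lambda>X. J x *v \<Gamma> x X Y)"
    using linear_compose[OF christoffel_linear_left[OF x] J_linear] unfolding o_def .
  then show ?thesis
    unfolding T_eq by (intro linear_compose_sub N_linear_direction J_differentiable x)
qed

lemma T_linear_2: assumes x: "x \<in> U" shows "linear (\<lambda>Y. T x X Y)"
proof -
  have l: "dir_deriv (\<lambda>y. J y *v Y) x X = dir_deriv J x X *v Y" for Y
    using C2_J x unfolding C2_on_def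
    by (intro dir_deriv_bounded_linear(1)[OF bounded_linear_matrix_apply]) auto
  show ?thesis
    unfolding T_eq nabla_def l
    by (rule linearI) (simp_all add: christoffel_simps[OF x] algebra_simps)
qed

lemmas T_simps =
  T_linear_1[THEN linear_add] T_linear_2[THEN linear_add]
  T_linear_1[THEN linear_diff] T_linear_2[THEN linear_diff]
  T_linear_1[THEN linear_neg] T_linear_2[THEN linear_neg]
  T_linear_1[THEN linear_scale] T_linear_2[THEN linear_scale]
  T_linear_1[THEN linear_0] T_linear_2[THEN linear_0]

lemma N_T:
  "N V (\<lambda>y. T y X Y) x = T2 x V X Y + T x (\<Gamma> x V X) Y + T x X (\<Gamma> x V Y)"
  unfolding T2_def by simp

lemma N_T_field:
  assumes x: "x \<in> U" and f: "f differentiable (at x)"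
  shows "N V (\<lambda>y. T y X (f y)) x = T2 x V X (f x) + T x (\<Gamma> x V X) (f x) + T x X (N V f x)"
proof -
  have "dir_deriv (\<lambda>y. T y X (f y)) x V = dir_deriv (\<lambda>y. T y X (f x)) x V + T x X (dir_deriv f x V)"
    by (rule leibniz_linear(2)[OF open_U x T_linear_2 T_differentiable[OF x] f])
  then have "N V (\<lambda>y. T y X (f y)) x = N V (\<lambda>y. T y X (f x)) x + T x X (dir_deriv f x V)"
    unfolding nabla_def by simp
  then show ?thesis
    unfolding N_T by (simp add: nabla_def T_simps[OF x])
qed

text \<open>The covariant derivative of \<open>J J = -1\<close>.\<close>

lemma T_anticommutes:
  assumes x: "x \<in> U"
  shows "T x X (J x *v Y) = - (J x *v T x X Y)"
proof -
  have "N X (\<lambda>y. J y *v (J y *v Y)) x = N X (\<lambda>_. - Y) x"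
    by (rule N_cong[OF x J_J])
  moreover have "N X (\<lambda>_. - Y) x = - \<Gamma> x X Y"
    by (simp add: N_const christoffel_simps[OF x])
  moreover have "N X (\<lambda>y. J y *v (J y *v Y)) x
      = T x X (J x *v Y) + J x *v (T x X Y) + J x *v (J x *v \<Gamma> x X Y)"
    by (simp add: N_J[OF x] J_differentiable[OF x] N_const algebra_simps)
  ultimately show ?thesis by (simp add: J_J[OF x] eq_neg_iff_add_eq_0)
qed

text \<open>The derivative of the previous identity.  The terms that contain Christoffel symbols cancel by that
  identity itself; the products of first derivatives remain.\<close>

lemma T2_anticommutator:
  assumes x: "x \<in> U"
  shows "T2 x V X (J x *v Y) + J x *v T2 x V X Y = - T x X (T x V Y) - T x V (T x X Y)"
proof -
  note d = T_differentiable[OF x] J_differentiable[OF x] 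
  have "(\<lambda>y. T y X (J y *v Y)) differentiable (at x)"
    by (rule leibniz_linear(1)[OF open_U x T_linear_2 d])
  then have "N V (\<lambda>y. T y X (J y *v Y) + J y *v T y X Y) x
      = N V (\<lambda>y. T y X (J y *v Y)) x + N V (\<lambda>y. J y *v T y X Y) x"
    by (intro N_add J_field_differentiable d x)
  also have "\<dots> = T2 x V X (J x *v Y) + T x (\<Gamma> x V X) (J x *v Y)
      + T x X (T x V Y + J x *v \<Gamma> x V Y)
      + T x V (T x X Y) + J x *v (T2 x V X Y + T x (\<Gamma> x V X) Y + T x X (\<Gamma> x V Y))"
    by (simp add: N_T_field[OF x] N_J[OF x] d N_T N_const)
  also have "\<dots> = T2 x V X (J x *v Y) + J x *v T2 x V X Y + T x X (T x V Y) + T x V (T x X Y)"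
    by (simp add: T_simps[OF x] T_anticommutes[OF x] algebra_simps)
  finally have "T2 x V X (J x *v Y) + J x *v T2 x V X Y + T x X (T x V Y) + T x V (T x X Y)
      = N V (\<lambda>_. 0) x"
    using N_cong[OF x, of "\<lambda>y. T y X (J y *v Y) + J y *v T y X Y" "\<lambda>_. 0" V]
    by (simp add: T_anticommutes)
  also have "N V (\<lambda>_. 0) x = 0"
    by (simp add: N_const linear_0[OF christoffel_linear_right[OF x]])
  finally have zero: "T2 x V X (J x *v Y) + J x *v T2 x V X Y + T x X (T x V Y) + T x V (T x X Y) = 0" .
  have "T2 x V X (J x *v Y) + J x *v T2 x V X Y
      = (T2 x V X (J x *v Y) + J x *v T2 x V X Y + T x X (T x V Y) + T x V (T x X Y))
        - T x X (T x V Y) - T x V (T x X Y)" by simp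
  then show ?thesis unfolding zero by simp
qed

lemma T_skew:
  assumes x: "x \<in> U"
  shows "metric g x (T x X Y) Z = - metric g x Y (T x X Z)"
proof -
  note J = J_differentiable[OF x] and c = differentiable_const
  have "dir_deriv (\<lambda>y. metric g y (J y *v Y) Z) x X = dir_deriv (\<lambda>y. - metric g y Y (J y *v Z)) x X"
    by (rule dir_deriv_cong[OF open_U x J_skew])
  also have "\<dots> = - dir_deriv (\<lambda>y. metric g y Y (J y *v Z)) x X"
    by (rule dir_deriv_bounded_linear(1)[OF bounded_linear_minus[OF bounded_linear_ident]])
      (intro metric_fields_differentiable x J c)
  finally show ?thesis
    unfolding metric_compatible[OF x J c] metric_compatible[OF x c J] N_const
    by (simp add: N_J[OF x c] N_const metric_simps J_skew[OF x])
qed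

lemma dir_deriv_metric_T:
  assumes x: "x \<in> U"
  shows "dir_deriv (\<lambda>y. metric g y (T y X Y) Z) x V
    = metric g x (T2 x V X Y) Z + metric g x (T x (\<Gamma> x V X) Y) Z
      + metric g x (T x X (\<Gamma> x V Y)) Z + metric g x (T x X Y) (\<Gamma> x V Z)"
  unfolding metric_compatible[OF x T_differentiable[OF x] differentiable_const] N_const N_T
  by (simp add: metric_simps)

lemma metric_T_differentiable:
  "x \<in> U \<Longrightarrow> (\<lambda>y. metric g y (T y X Y) Z) differentiable (at x)"
  by (intro metric_fields_differentiable T_differentiable differentiable_const)

lemma T2_skew:
  assumes x: "x \<in> U"
  shows "metric g x (T2 x V X Y) Z = - metric g x Y (T2 x V X Z)"
proof -
  have "dir_deriv (\<lambda>y. metric g y (T y X Y) Z) x V = dir_deriv (\<lambda>y. - metric g y (T y X Z) Y) x V"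
    by (rule dir_deriv_cong[OF open_U x]) (metis T_skew metric_sym)
  also have "\<dots> = - dir_deriv (\<lambda>y. metric g y (T y X Z) Y) x V"
    by (rule dir_deriv_bounded_linear(1)[OF bounded_linear_minus[OF bounded_linear_ident]
        metric_T_differentiable[OF x]])
  finally show ?thesis
    unfolding dir_deriv_metric_T[OF x]
    using T_skew[OF x, of "\<Gamma> x V X" Y Z] T_skew[OF x, of X "\<Gamma> x V Y" Z] T_skew[OF x, of X "\<Gamma> x V Z" Y]
      metric_sym[OF x, of Y "T2 x V X Z"] metric_sym[OF x, of "T x X Y" "\<Gamma> x V Z"]
      metric_sym[OF x, of Y "T x (\<Gamma> x V X) Z"] metric_sym[OF x, of "T x X Z" "\<Gamma> x V Y"]
      metric_sym[OF x, of "T x X Y" "\<Gamma> x V Z"] metric_sym[OF x, of "\<Gamma> x V Z" "T x X Y"]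
    by linarith
qed

text \<open>As the connection is torsion-free, \<open>d\<Omega>\<close> is the cyclic sum of \<open>\<nabla>\<Omega>\<close>.\<close>

lemma T_cyclic:
  assumes x: "x \<in> U"
  shows "metric g x (T x X Y) Z + metric g x (T x Y Z) X + metric g x (T x Z X) Y = 0"
proof -
  note J = J_differentiable[OF x] and c = differentiable_const
  have D: "dir_deriv (\<lambda>y. fundamental_form g J y Y Z) x X
    = metric g x (T x X Y) Z - metric g x (\<Gamma> x X Y) (J x *v Z) + metric g x (J x *v Y) (\<Gamma> x X Z)"
    for X Y Z
    unfolding fundamental_form_def form_of_def metric_compatible[OF x J c] N_const
    by (simp add: N_J[OF x c] N_const metric_simps J_skew[OF x])
  show ?thesis
    using closed[OF x, of X Y Z] unfolding ext_deriv2_def D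
    using christoffel_sym[OF x, of X Y] christoffel_sym[OF x, of Y Z] christoffel_sym[OF x, of Z X]
    by (simp add: metric_sym[OF x, of "J x *v _"])
qed

lemma T2_cyclic:
  assumes x: "x \<in> U"
  shows "metric g x (T2 x V X Y) Z + metric g x (T2 x V Y Z) X + metric g x (T2 x V Z X) Y = 0"
proof -
  note d = metric_T_differentiable[OF x]
  have "dir_deriv (\<lambda>y. metric g y (T y X Y) Z + metric g y (T y Y Z) X + metric g y (T y Z X) Y) x V
      = dir_deriv (\<lambda>_. 0) x V"
    by (rule dir_deriv_cong[OF open_U x T_cyclic])
  then have "dir_deriv (\<lambda>y. metric g y (T y X Y) Z) x V + dir_deriv (\<lambda>y. metric g y (T y Y Z) X) x V
      + dir_deriv (\<lambda>y. metric g y (T y Z X) Y) x V = 0"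
    by (simp add: dir_deriv_add d differentiable_add)
  then show ?thesis
    unfolding dir_deriv_metric_T[OF x]
    using T_cyclic[OF x, of "\<Gamma> x V X" Y Z] T_cyclic[OF x, of X "\<Gamma> x V Y" Z]
      T_cyclic[OF x, of X Y "\<Gamma> x V Z"]
    by linarith
qed

text \<open>The Ricci identity for \<open>J\<close>: differentiate \<open>(\<nabla>\<^sub>X J) Y = \<nabla>\<^sub>X (J Y) - J \<nabla>\<^sub>X Y\<close> once more and apply the
  commutation formula to the fields \<open>J Y\<close> and \<open>Y\<close>.\<close>

lemma T2_commutator:
  assumes x: "x \<in> U"
  shows "T2 x V X Y - T2 x X V Y = curvature g x V X (J x *v Y) - J x *v curvature g x V X Y"
proof -
  have NT: "N V (\<lambda>y. T y X Y) x = N V (\<lambda>y. N X (\<lambda>y. J y *v Y) y) x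
      - T x V (\<Gamma> x X Y) - J x *v N V (\<lambda>y. \<Gamma> y X Y) x" for V X
    unfolding T_eq[of _ X Y]
    by (simp add: N_diff N_differentiable C2_J_apply J_field_differentiable N_J
        christoffel_differentiable x)
  have "T2 x V X Y - T2 x X V Y =
     (N V (\<lambda>y. N X (\<lambda>y. J y *v Y) y) x - N X (\<lambda>y. N V (\<lambda>y. J y *v Y) y) x)
     - J x *v (N V (\<lambda>y. \<Gamma> y X Y) x - N X (\<lambda>y. \<Gamma> y V Y) x)"
    unfolding T2_def NT by (simp add: christoffel_sym[OF x, of X V] algebra_simps)
  then show ?thesis
    unfolding N_commutator[OF x C2_J_apply] curvature_eq[OF x, of V X Y] .
qed

end


section \<open>Contractions in orthonormal frames\<close>

context riemann_chart
begin

lemma frame_expansion: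
  assumes E: "orthonormal_frame g x E" and x: "x \<in> U"
  shows "v = (\<Sum>k\<in>UNIV. metric g x v (E k) *\<^sub>R E k)"
proof -
  define P :: "real^'n^'n" where "P = (\<chi> i k. E k $ i)"
  have col: "P *v w = (\<Sum>k\<in>UNIV. w $ k *\<^sub>R E k)" for w
    unfolding P_def by (simp add: vec_eq_iff matrix_vector_mult_def mult.commute)
  have row: "(transpose P ** g x) *v w = (\<chi> k. metric g x (E k) w)" for w
    unfolding P_def metric_def
    by (simp add: vec_eq_iff matrix_vector_mul_assoc[symmetric])
      (simp add: transpose_def vector_matrix_mult_def inner_vec_def mult.commute)
  have "(transpose P ** g x) ** P = mat 1"
  proof -
    have "((transpose P ** g x) ** P) *v axis k 1 = axis k 1" for k
    proof -
      have "P *v axis k 1 = E k"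
        unfolding P_def by (simp add: matrix_vector_mult_basis column_def vec_eq_iff)
      then have "((transpose P ** g x) ** P) *v axis k 1 = (\<chi> i. metric g x (E i) (E k))"
        by (simp add: row flip: matrix_vector_mul_assoc[of "transpose P ** g x"])
      then show ?thesis
        using E unfolding orthonormal_frame_def by (simp add: vec_eq_iff axis_def)
    qed
    then have "column k ((transpose P ** g x) ** P) = column k (mat 1)" for k
      by (simp flip: matrix_vector_mult_basis)
    then show ?thesis by (simp add: column_def vec_eq_iff)
  qed
  then have "P ** (transpose P ** g x) = mat 1"
    using matrix_left_right_inverse by blast
  then have "v = P *v ((transpose P ** g x) *v v)"
    by (simp add: matrix_vector_mul_assoc)
  also have "\<dots> = (\<Sum>k\<in>UNIV. metric g x v (E k) *\<^sub>R E k)"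
    unfolding row col by (simp add: metric_sym[OF x, of v])
  finally show ?thesis .
qed

lemma frame_eqI:
  assumes "x \<in> U" "orthonormal_frame g x E" "\<And>k. metric g x v (E k) = metric g x w (E k)"
  shows "v = w"
  using frame_expansion[OF assms(2,1), of v] frame_expansion[OF assms(2,1), of w] assms(3) by simp

lemma linear_frame_expansion:
  assumes "x \<in> U" "orthonormal_frame g x E" "linear f"
  shows "f v = (\<Sum>k\<in>UNIV. metric g x v (E k) *\<^sub>R f (E k))"
proof -
  have "f v = f (\<Sum>k\<in>UNIV. metric g x v (E k) *\<^sub>R E k)"
    using frame_expansion[OF assms(2,1), of v] by simp
  then show ?thesis by (simp add: linear_sum[OF assms(3)] linear_scale[OF assms(3)])
qed

lemma contraction_frame_independent:
  assumes x: "x \<in> U" and E: "orthonormal_frame g x E" and F: "orthonormal_frame g x F"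
    and B1: "\<And>Y. linear (\<lambda>X. B X Y)" and B2: "\<And>X. linear (\<lambda>Y. B X Y)"
  shows "(\<Sum>k\<in>UNIV. B (E k) (E k)) = (\<Sum>k\<in>UNIV. B (F k) (F k))"
proof -
  have "(\<Sum>k\<in>UNIV. B (E k) (E k)) = (\<Sum>k\<in>UNIV. \<Sum>l\<in>UNIV. metric g x (E k) (F l) *\<^sub>R B (E k) (F l))"
    by (intro sum.cong refl linear_frame_expansion[OF x F B2])
  also have "\<dots> = (\<Sum>l\<in>UNIV. \<Sum>k\<in>UNIV. metric g x (F l) (E k) *\<^sub>R B (E k) (F l))"
    by (subst sum.swap) (simp add: metric_sym[OF x, of "E _" "F _"])
  also have "\<dots> = (\<Sum>l\<in>UNIV. B (F l) (F l))"
    by (intro sum.cong refl linear_frame_expansion[OF x E B1, symmetric])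
  finally show ?thesis .
qed

lemma trace_frame:
  assumes x: "x \<in> U" and E: "orthonormal_frame g x E" and f: "linear f"
  shows "(\<Sum>i\<in>UNIV. f (axis i 1) $ i) = (\<Sum>k\<in>UNIV. metric g x (f (E k)) (E k))"
proof -
  have "metric g x (f (E k)) (E k) = (\<Sum>i\<in>UNIV. E k $ i * metric g x (f (axis i 1)) (E k))" for k
    using linear_eq_sum_axis[OF linear_compose[OF f metric_linear_left[of g x "E k"]], of "E k"]
    by (simp add: o_def)
  then have "(\<Sum>k\<in>UNIV. metric g x (f (E k)) (E k))
      = (\<Sum>i\<in>UNIV. \<Sum>k\<in>UNIV. E k $ i * metric g x (f (axis i 1)) (E k))"
    by (simp only:) (rule sum.swap)
  also have "\<dots> = (\<Sum>i\<in>UNIV. (\<Sum>k\<in>UNIV. metric g x (f (axis i 1)) (E k) *\<^sub>R E k) $ i)"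
    by (simp add: mult.commute)
  also have "\<dots> = (\<Sum>i\<in>UNIV. f (axis i 1) $ i)"
    by (simp only: frame_expansion[OF E x, symmetric])
  finally show ?thesis ..
qed

end

lemma trace_commute:
  fixes f h :: "real^'n::finite \<Rightarrow> real^'n"
  assumes "linear f" "linear h"
  shows "(\<Sum>i\<in>UNIV. f (h (axis i 1)) $ i) = (\<Sum>i\<in>UNIV. h (f (axis i 1)) $ i)"
proof -
  have tr: "(\<Sum>i\<in>UNIV. k (axis i 1) $ i) = trace (matrix k)" for k :: "real^'n \<Rightarrow> real^'n"
    by (simp add: trace_def matrix_def)
  have "trace (matrix (f \<circ> h)) = trace (matrix (h \<circ> f))"
    using assms by (simp add: matrix_compose trace_mul_sym[of "matrix f"])
  then show ?thesis using tr[of "f \<circ> h"] tr[of "h \<circ> f"] by (simp add: o_def)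
qed

context almost_kaehler_chart
begin

lemma J_frame:
  assumes "x \<in> U" "orthonormal_frame g x E"
  shows "orthonormal_frame g x (\<lambda>k. J x *v E k)"
  using assms(2) unfolding orthonormal_frame_def J_isometry[OF assms(1)] .

lemma contraction_J:
  assumes x: "x \<in> U" and E: "orthonormal_frame g x E"
    and B: "\<And>Y. linear (\<lambda>X. B X Y)" "\<And>X. linear (\<lambda>Y. B X Y)"
  shows "(\<Sum>k\<in>UNIV. B (J x *v E k) (J x *v E k)) = (\<Sum>k\<in>UNIV. B (E k) (E k))"
  by (rule contraction_frame_independent[OF x J_frame[OF x E] E B])

text \<open>\<open>\<Omega>\<close> is coclosed.  In the cyclic identity for \<open>E\<^sub>k\<close>, \<open>J E\<^sub>k\<close>, \<open>Z\<close>, summed over \<open>k\<close>, the first two terms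
  are both minus the divergence at \<open>J Z\<close>, and the third one is minus the trace of \<open>J \<nabla>\<^sub>Z J\<close>, which
  vanishes because \<open>J\<close> anticommutes with \<open>\<nabla>\<^sub>Z J\<close>.\<close>

lemma T_divergence:
  assumes x: "x \<in> U" and E: "orthonormal_frame g x E"
  shows "(\<Sum>k\<in>UNIV. metric g x (T x (E k) Z) (E k)) = 0"
proof -
  note lin = linear_compose[OF T_linear_1[OF x] metric_linear_left, unfolded o_def]
    linear_compose[OF T_linear_2[OF x] metric_linear_left, unfolded o_def]
    linear_compose[OF J_linear metric_linear_right, unfolded o_def]
  have main: "(\<Sum>k\<in>UNIV. metric g x (T x (E k) Z) (J x *v E k)) = 0" for Z
  proof -
    define s where "s = (\<Sum>k\<in>UNIV. metric g x (T x (E k) Z) (J x *v E k))"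
    define t where "t = (\<Sum>k\<in>UNIV. metric g x (T x Z (E k)) (J x *v E k))"
    have "t = (\<Sum>k\<in>UNIV. metric g x (T x Z (J x *v E k)) (J x *v (J x *v E k)))"
      unfolding t_def by (rule contraction_J[OF x E, symmetric]) (rule lin)+
    also have "\<dots> = - t"
      unfolding t_def by (simp add: J_J[OF x] T_anticommutes[OF x] J_skew[OF x] metric_simps sum_negf)
    finally have t: "t = 0" by simp
    have "s = (\<Sum>k\<in>UNIV. metric g x (T x (J x *v E k) Z) (J x *v (J x *v E k)))"
      unfolding s_def by (rule contraction_J[OF x E, symmetric]) (rule lin)+
    then have s: "s = - (\<Sum>k\<in>UNIV. metric g x (T x (J x *v E k) Z) (E k))"
      by (simp add: J_J[OF x] metric_simps sum_negf)
    have "metric g x (T x (E k) (J x *v E k)) Z = - metric g x (T x (E k) Z) (J x *v E k)" for k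
      using T_skew[OF x, of "E k" "J x *v E k" Z] metric_sym[OF x] by simp
    then have "0 = (\<Sum>k\<in>UNIV. - metric g x (T x (E k) Z) (J x *v E k)
        + metric g x (T x (J x *v E k) Z) (E k) + metric g x (T x Z (E k)) (J x *v E k))"
      using T_cyclic[OF x, of "E k" "J x *v E k" Z for k] by simp
    also have "\<dots> = - s - s + t"
      unfolding sum.distrib t_def[symmetric] sum_negf s_def[symmetric] using s by simp
    finally show ?thesis using t unfolding s_def by simp
  qed
  show ?thesis
    using main[of "J x *v Z"] by (simp add: T_anticommutes[OF x] metric_simps J_isometry[OF x] sum_negf)
qed

lemma T2_linear_2: assumes x: "x \<in> U" shows "linear (\<lambda>X. T2 x V X Y)"
proof -
  note d = T_differentiable[OF x]
  have "linear (\<lambda>X. N V (\<lambda>y. T y X Y) x)"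
  proof (rule linearI)
    fix X X' and c :: real
    have "N V (\<lambda>y. T y (X + X') Y) x = N V (\<lambda>y. T y X Y + T y X' Y) x"
      by (rule N_cong[OF x]) (simp add: T_simps)
    then show "N V (\<lambda>y. T y (X + X') Y) x = N V (\<lambda>y. T y X Y) x + N V (\<lambda>y. T y X' Y) x"
      by (simp add: N_add[OF d d x])
    have "N V (\<lambda>y. T y (c *\<^sub>R X) Y) x = N V (\<lambda>y. c *\<^sub>R T y X Y) x"
      by (rule N_cong[OF x]) (simp add: T_simps)
    then show "N V (\<lambda>y. T y (c *\<^sub>R X) Y) x = c *\<^sub>R N V (\<lambda>y. T y X Y) x"
      unfolding nabla_def
      by (simp add: dir_deriv_bounded_linear(1)[OF bounded_linear_scaleR_right d] christoffel_simps[OF x]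
          scaleR_add_right)
  qed
  moreover have "linear (\<lambda>X. T x (\<Gamma> x V X) Y)"
    using linear_compose[OF christoffel_linear_right[OF x] T_linear_1[OF x]] unfolding o_def .
  ultimately show ?thesis
    unfolding T2_def by (intro linear_compose_sub T_linear_1[OF x])
qed

lemma T2_linear_3: assumes x: "x \<in> U" shows "linear (\<lambda>Y. T2 x V X Y)"
proof (rule linearI; rule metric_eqI[OF x])
  fix Y Z W and c :: real
  show "metric g x (T2 x V X (Y + Z)) W = metric g x (T2 x V X Y + T2 x V X Z) W"
    by (simp add: T2_skew[OF x, of V X _ W] metric_simps)
  show "metric g x (T2 x V X (c *\<^sub>R Y)) W = metric g x (c *\<^sub>R T2 x V X Y) W"
    by (simp add: T2_skew[OF x, of V X _ W] metric_simps)
qed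

text \<open>The divergence is a trace, hence independent of the metric; so its vanishing can be
  differentiated in the constant coordinate frame, the connection terms cancelling by the
  commutativity of the trace.\<close>

lemma T2_divergence:
  assumes frames: "\<And>y. y \<in> U \<Longrightarrow> \<exists>E. orthonormal_frame g y E"
    and x: "x \<in> U" and E: "orthonormal_frame g x E"
  shows "(\<Sum>k\<in>UNIV. metric g x (T2 x V (E k) Z) (E k)) = 0"
proof -
  have div: "(\<Sum>i\<in>UNIV. T y (axis i 1) Z $ i) = 0" if y: "y \<in> U" for y Z
  proof -
    obtain F where F: "orthonormal_frame g y F" using frames[OF y] ..
    show ?thesis
      unfolding trace_frame[OF y F T_linear_1[OF y]] by (rule T_divergence[OF y F])
  qed
  have bl: "bounded_linear (\<lambda>v::real^'n. v $ i)" for i by (rule bounded_linear_vec_nth)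
  have comp: "((\<lambda>y. T y (axis i 1) Z $ i) has_derivative
      (\<lambda>V. dir_deriv (\<lambda>y. T y (axis i 1) Z) x V $ i)) (at x)" for i
    by (rule bounded_linear.has_derivative[OF bl has_dir_deriv[OF T_differentiable[OF x]]])
  have "((\<lambda>y. \<Sum>i\<in>UNIV. T y (axis i 1) Z $ i) has_derivative
      (\<lambda>V. \<Sum>i\<in>UNIV. dir_deriv (\<lambda>y. T y (axis i 1) Z) x V $ i)) (at x)"
    by (intro has_derivative_sum comp)
  then have "(\<Sum>i\<in>UNIV. dir_deriv (\<lambda>y. T y (axis i 1) Z) x V $ i)
      = dir_deriv (\<lambda>y. \<Sum>i\<in>UNIV. T y (axis i 1) Z $ i) x V"
    by (rule dir_deriv_eq[symmetric])
  also have "\<dots> = dir_deriv (\<lambda>_. 0) x V"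
    by (rule dir_deriv_cong[OF open_U x div])
  finally have "(\<Sum>i\<in>UNIV. dir_deriv (\<lambda>y. T y (axis i 1) Z) x V $ i) = 0" by simp
  moreover have "dir_deriv (\<lambda>y. T y X Z) x V
      = T2 x V X Z + T x (\<Gamma> x V X) Z + T x X (\<Gamma> x V Z) - \<Gamma> x V (T x X Z)" for X
    using N_T[of V X Z x] unfolding nabla_def by (simp add: algebra_simps)
  ultimately have "(\<Sum>i\<in>UNIV. T2 x V (axis i 1) Z $ i) + (\<Sum>i\<in>UNIV. T x (\<Gamma> x V (axis i 1)) Z $ i)
      + (\<Sum>i\<in>UNIV. T x (axis i 1) (\<Gamma> x V Z) $ i) - (\<Sum>i\<in>UNIV. \<Gamma> x V (T x (axis i 1) Z) $ i) = 0"
    by (simp add: sum.distrib sum_subtractf)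
  then have "(\<Sum>i\<in>UNIV. T2 x V (axis i 1) Z $ i) = 0"
    using div[OF x] trace_commute[OF T_linear_1[OF x, of Z] christoffel_linear_right[OF x, of V]] by simp
  then show ?thesis
    using trace_frame[OF x E T2_linear_2[OF x]] by simp
qed


section \<open>The scalar curvature and the star-scalar curvature\<close>

text \<open>This is the Bochner formula for the closed and coclosed form \<open>\<Omega>\<close>.  The length of \<open>\<Omega>\<close> is constant, so
  the formula contains no Laplacian of it and bounds \<open>\<nabla>J\<close> at each point.  In the derivative of the cyclic
  identity, contracted with \<open>J\<close>, the first term is \<open>- |\<nabla>J|\<^sup>2\<close> by \<open>J\<^sup>2 = -1\<close>.  The other two are equal, and the
  Ricci identity turns them into derivatives of the divergence, which are zero, and curvature terms.\<close>

lemma star_scalar_curvature: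
  assumes frames: "\<And>y. y \<in> U \<Longrightarrow> \<exists>E. orthonormal_frame g y E"
    and x: "x \<in> U" and E: "orthonormal_frame g x E"
  shows "(\<Sum>k\<in>UNIV. \<Sum>l\<in>UNIV. metric g x (curvature g x (E k) (E l) (J x *v E l)) (J x *v E k))
    - (\<Sum>k\<in>UNIV. \<Sum>l\<in>UNIV. metric g x (curvature g x (E k) (E l) (E l)) (E k))
    = (\<Sum>k\<in>UNIV. \<Sum>l\<in>UNIV. metric g x (T x (E k) (E l)) (T x (E k) (E l))) / 2"
proof -
  \<comment> \<open>The anticommutator of \<open>J\<close> with \<open>\<nabla>\<^sup>2\<^bsub>k,k\<^esub> J\<close>, paired with \<open>E\<^sub>l\<close>.\<close>
  have first: "metric g x (T2 x (E k) (E k) (E l)) (J x *v E l)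
      = - metric g x (T x (E k) (E l)) (T x (E k) (E l))" for k l
  proof -
    have "metric g x (T2 x (E k) (E k) (J x *v E l) + J x *v T2 x (E k) (E k) (E l)) (E l)
        = metric g x (- T x (E k) (T x (E k) (E l)) - T x (E k) (T x (E k) (E l))) (E l)"
      unfolding T2_anticommutator[OF x] ..
    then show ?thesis
      using T2_skew[OF x, of "E k" "E k" "J x *v E l" "E l"] J_skew[OF x, of "T2 x (E k) (E k) (E l)" "E l"]
        metric_sym[OF x, of "J x *v E l" "T2 x (E k) (E k) (E l)"]
        T_skew[OF x, of "E k" "T x (E k) (E l)" "E l"]
      unfolding metric_simps by linarith
  qed
  \<comment> \<open>The frame \<open>J E\<close> may replace \<open>E\<close> in the sum over \<open>l\<close>.\<close>
  have third: "(\<Sum>l\<in>UNIV. metric g x (T2 x (E k) (J x *v E l) (E k)) (E l))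
      = (\<Sum>l\<in>UNIV. metric g x (T2 x (E k) (E l) (J x *v E l)) (E k))" for k
  proof -
    have "metric g x (T2 x (E k) (J x *v E l) (E k)) (E l)
        = metric g x (T2 x (E k) (J x *v E l) (J x *v (J x *v E l))) (E k)" for l
      using T2_skew[OF x, of "E k" "J x *v E l" "E k" "E l"] metric_sym[OF x, of "E k"]
      by (simp add: J_J[OF x] linear_neg[OF T2_linear_3[OF x]] metric_simps)
    then have "(\<Sum>l\<in>UNIV. metric g x (T2 x (E k) (J x *v E l) (E k)) (E l))
        = (\<Sum>l\<in>UNIV. metric g x (T2 x (E k) (J x *v E l) (J x *v (J x *v E l))) (E k))" by simp
    also have "\<dots> = (\<Sum>l\<in>UNIV. metric g x (T2 x (E k) (E l) (J x *v E l)) (E k))"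
    proof (rule contraction_J[OF x E, where B = "\<lambda>X Y. metric g x (T2 x (E k) X (J x *v Y)) (E k)"])
      show "linear (\<lambda>X. metric g x (T2 x (E k) X (J x *v Y)) (E k))" for Y
        using linear_compose[OF T2_linear_2[OF x] metric_linear_left] unfolding o_def .
      show "linear (\<lambda>Y. metric g x (T2 x (E k) X (J x *v Y)) (E k))" for X
        using linear_compose[OF linear_compose[OF J_linear T2_linear_3[OF x]] metric_linear_left]
        unfolding o_def .
    qed
    finally show ?thesis .
  qed
  \<comment> \<open>The Ricci identity exchanges \<open>k\<close> and \<open>l\<close>, so that the sum over \<open>k\<close> becomes a divergence.\<close>
  have second: "metric g x (T2 x (E k) (E l) (J x *v E l)) (E k)
      = metric g x (T2 x (E l) (E k) (J x *v E l)) (E k)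
        - metric g x (curvature g x (E k) (E l) (E l)) (E k)
        + metric g x (curvature g x (E k) (E l) (J x *v E l)) (J x *v E k)" for k l
  proof -
    have "metric g x (T2 x (E k) (E l) (J x *v E l)) (E k) - metric g x (T2 x (E l) (E k) (J x *v E l)) (E k)
      = metric g x (curvature g x (E k) (E l) (J x *v (J x *v E l)) - J x *v curvature g x (E k) (E l) (J x *v E l)) (E k)"
      unfolding T2_commutator[OF x, symmetric] by (simp add: metric_simps)
    then show ?thesis
      by (simp add: J_J[OF x] linear_neg[OF curvature_linear_3[OF x]] metric_simps J_skew[OF x])
  qed
  have div: "(\<Sum>k\<in>UNIV. \<Sum>l\<in>UNIV. metric g x (T2 x (E l) (E k) (J x *v E l)) (E k)) = 0"
    by (subst sum.swap) (simp add: T2_divergence[OF frames x E])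
  have "0 = (\<Sum>k\<in>UNIV. \<Sum>l\<in>UNIV. metric g x (T2 x (E k) (E k) (E l)) (J x *v E l)
      + metric g x (T2 x (E k) (E l) (J x *v E l)) (E k) + metric g x (T2 x (E k) (J x *v E l) (E k)) (E l))"
    by (simp add: T2_cyclic[OF x])
  also have "\<dots> = - (\<Sum>k\<in>UNIV. \<Sum>l\<in>UNIV. metric g x (T x (E k) (E l)) (T x (E k) (E l)))
      + 2 * (\<Sum>k\<in>UNIV. \<Sum>l\<in>UNIV. metric g x (T2 x (E k) (E l) (J x *v E l)) (E k))"
    unfolding sum.distrib third first by (simp add: sum_negf)
  finally show ?thesis
    unfolding second sum.distrib sum_subtractf div by simp
qed

end


section \<open>Algebraic curvature tensors in dimension four\<close>

definition next_axis :: "4 \<Rightarrow> 4" where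
  "next_axis a = (if a = 2 then 3 else if a = 3 then 4 else 2)"

text \<open>For \<open>a = 2, 3, 4\<close> these are the components of the self-dual form \<open>e\<^sup>1 \<and> e\<^sup>a + e\<^sup>b \<and> e\<^sup>c\<close>, where \<open>a\<close>, \<open>b\<close>, \<open>c\<close>
  is a cyclic permutation of 2, 3, 4.  In a frame adapted to \<open>J\<close> the first of the three forms is \<open>\<Omega>\<close>.\<close>

definition sd_coeff :: "4 \<Rightarrow> 4 \<Rightarrow> 4 \<Rightarrow> real" where
  "sd_coeff a k p =
    (if k = 1 \<and> p = a then 1
     else if k = a \<and> p = 1 then - 1
     else if k = next_axis a \<and> p = next_axis (next_axis a) then 1
     else if k = next_axis (next_axis a) \<and> p = next_axis a then - 1
     else 0)"

locale curvature_tensor4 =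
  fixes r :: "4 \<Rightarrow> 4 \<Rightarrow> 4 \<Rightarrow> 4 \<Rightarrow> real"
  assumes antisym1: "r i j k l = - r j i k l"
    and antisym2: "r i j k l = - r i j l k"
    and bianchi: "r i j k l + r j k i l + r k i j l = 0"
begin

text \<open>The four Bianchi identities that start at \<open>i\<close>, \<open>j\<close>, \<open>k\<close>, \<open>l\<close>, the faces of the usual octahedron.\<close>

lemma pair_sym: "r i j k l = r k l i j"
  using bianchi[of i j k l] bianchi[of j k l i] bianchi[of k l i j] bianchi[of l i j k]
    antisym2[of j k l i] antisym2[of k l j i] antisym2[of l j k i] antisym1[of l j i k]
    antisym2[of l i k j] antisym2[of i k l j] antisym1[of i k j l] antisym2[of i j l k]
  by linarith

definition ric :: "4 \<Rightarrow> 4 \<Rightarrow> real" where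
  "ric i l = (\<Sum>k\<in>UNIV. r i k k l)"

definition scal :: real where
  "scal = (\<Sum>i\<in>UNIV. ric i i)"

text \<open>The contraction of the curvature with \<open>J\<close> in its last two arguments, \<open>J\<close> having the components
  \<open>sd_coeff 2\<close>.\<close>

definition star_scal :: real where
  "star_scal = (\<Sum>k\<in>UNIV. \<Sum>l\<in>UNIV. \<Sum>q\<in>UNIV. \<Sum>p\<in>UNIV. sd_coeff 2 l p * sd_coeff 2 k q * r k l p q)"

definition W :: "4 \<Rightarrow> 4 \<Rightarrow> 4 \<Rightarrow> 4 \<Rightarrow> real" where
  "W i j k l = r i j k l
     - ((if j = k then ric i l else 0) - (if i = k then ric j l else 0)
        + (if i = l then ric j k else 0) - (if j = l then ric i k else 0)) / 2
     + scal / 6 * ((if j = k \<and> i = l then 1 else 0) - (if j = l \<and> i = k then 1 else 0))"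

text \<open>The Weyl tensor applied to the self-dual form number \<open>a\<close>.  For \<open>a, b \<in> {2, 3, 4}\<close> the number
  \<open>weyl_form a 1 b\<close> is the entry of the matrix of \<open>W\<^sub>+\<close> in the basis of the three forms.\<close>

definition weyl_form :: "4 \<Rightarrow> 4 \<Rightarrow> 4 \<Rightarrow> real" where
  "weyl_form a m l = (\<Sum>k\<in>UNIV. \<Sum>p\<in>UNIV. sd_coeff a k p * W p k m l)"

lemma r_diag: "r i i k l = 0" "r i j k k = 0"
  using antisym1[of i i k l] antisym2[of i j k k] by linarith+

text \<open>Every component reduces to one of the twenty that survive all the symmetries.  With these rules, those
  for repeated indices and the Bianchi identity, the linear identities below become equalities of normal forms.\<close>

lemma r_normal:
  "r 2 1 k l = - r 1 2 k l" "r 3 1 k l = - r 1 3 k l" "r 4 1 k l = - r 1 4 k l"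
  "r 3 2 k l = - r 2 3 k l" "r 4 2 k l = - r 2 4 k l" "r 4 3 k l = - r 3 4 k l"
  "r i j 2 1 = - r i j 1 2" "r i j 3 1 = - r i j 1 3" "r i j 4 1 = - r i j 1 4"
  "r i j 3 2 = - r i j 2 3" "r i j 4 2 = - r i j 2 4" "r i j 4 3 = - r i j 3 4"
  "r 1 3 1 2 = r 1 2 1 3" "r 1 4 1 2 = r 1 2 1 4" "r 2 3 1 2 = r 1 2 2 3" "r 2 4 1 2 = r 1 2 2 4"
  "r 3 4 1 2 = r 1 2 3 4" "r 1 4 1 3 = r 1 3 1 4" "r 2 3 1 3 = r 1 3 2 3" "r 2 4 1 3 = r 1 3 2 4"
  "r 3 4 1 3 = r 1 3 3 4" "r 2 3 1 4 = r 1 4 2 3" "r 2 4 1 4 = r 1 4 2 4" "r 3 4 1 4 = r 1 4 3 4"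
  "r 2 4 2 3 = r 2 3 2 4" "r 3 4 2 3 = r 2 3 3 4" "r 3 4 2 4 = r 2 4 3 4"
  by (rule antisym1 antisym2 pair_sym)+

lemma r_bianchi: "r 1 4 2 3 = r 1 3 2 4 - r 1 2 3 4"
  using bianchi[of 1 2 3 4] pair_sym[of 2 3 1 4] antisym1[of 3 1 2 4] by linarith

lemmas W_expand = weyl_form_def W_def scal_def ric_def sum_4 sd_coeff_def next_axis_def r_diag r_normal r_bianchi

lemma weyl_form_skew: "weyl_form a m l = - weyl_form a l m"
proof -
  have "W i j m l = - W i j l m" for i j
    unfolding W_def antisym2[of i j m l] by (simp add: field_simps)
  then have "weyl_form a m l = (\<Sum>k\<in>UNIV. \<Sum>p\<in>UNIV. - (sd_coeff a k p * W p k l m))"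
    unfolding weyl_form_def by (intro sum.cong refl) (metis mult_minus_right)
  then show ?thesis unfolding weyl_form_def by (simp add: sum_negf)
qed

text \<open>Of the parts of the curvature only the trace-free Ricci tensor maps self-dual to anti-self-dual
  forms, and the Weyl tensor lacks it.\<close>

lemma weyl_form_self_dual:
  assumes "a \<in> {2, 3, 4}"
  shows "weyl_form a 3 4 = weyl_form a 1 2" "weyl_form a 2 4 = - weyl_form a 1 3" "weyl_form a 2 3 = weyl_form a 1 4"
  using assms by (auto simp: W_expand field_simps)

lemma weyl_form_sym:
  "weyl_form 3 1 2 = weyl_form 2 1 3" "weyl_form 4 1 2 = weyl_form 2 1 4" "weyl_form 4 1 3 = weyl_form 3 1 4"
  by (simp_all add: W_expand field_simps)

lemma weyl_form_trace: "weyl_form 2 1 2 + weyl_form 3 1 3 + weyl_form 4 1 4 = 0"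
  by (simp add: W_expand field_simps)

text \<open>By the Bianchi identity the curvature operator has the diagonal entry \<open>star_scal / 2\<close> at \<open>\<Omega>\<close>; the scalar
  part of the curvature contributes \<open>scal / 6\<close> of it.\<close>

lemma weyl_form_star: "weyl_form 2 1 2 = star_scal / 2 - scal / 6"
  by (simp add: star_scal_def W_expand field_simps)

text \<open>If the values of the curvature commute with \<open>J\<close>, then the self-dual part of the curvature operator
  has its image in the line of \<open>\<Omega>\<close>.  By symmetry all of its entries but that at \<open>\<Omega>\<close> vanish, and what remains
  of \<open>W\<^sub>+\<close> outside this line is minus the scalar part.\<close>

lemma weyl_form_kaehler:
  assumes "\<And>i j. r i j 2 4 = r i j 1 3" "\<And>i j. r i j 2 3 = - r i j 1 4"
  shows "weyl_form 2 1 3 = 0" "weyl_form 2 1 4 = 0" "weyl_form 3 1 4 = 0" "weyl_form 3 1 3 = - scal / 6" "weyl_form 4 1 4 = - scal / 6"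
proof -
  note a = assms(1)[of 1 2] assms(2)[of 1 2] assms(1)[of 1 3] assms(2)[of 1 3] assms(1)[of 1 4] assms(2)[of 1 4]
    assms(1)[of 2 3] assms(2)[of 2 3] assms(1)[of 2 4] assms(2)[of 2 4] assms(1)[of 3 4] assms(2)[of 3 4]
  note b = a[simplified r_normal r_bianchi]
  show "weyl_form 2 1 3 = 0" "weyl_form 2 1 4 = 0" "weyl_form 3 1 4 = 0" "weyl_form 3 1 3 = - scal / 6" "weyl_form 4 1 4 = - scal / 6"
    using b by (simp_all add: W_expand field_simps)
qed

end


section \<open>Adapted frames\<close>

lemma matrix_apply:
  fixes f :: "real^'n::finite \<Rightarrow> real^'m::finite"
  assumes "linear f" shows "matrix f *v X = f X"
  by (rule matrix_works) (simp add: linear_matrix_vector_mul_eq assms)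

lemma linear_mult_const:
  fixes f :: "'v::real_vector \<Rightarrow> real"
  assumes "linear f"
  shows "linear (\<lambda>X. f X * c)" "linear (\<lambda>X. c * f X)"
  using assms by (auto simp: linear_iff algebra_simps)

lemma linear_scaleR_vector: "linear f \<Longrightarrow> linear (\<lambda>X. f X *\<^sub>R v)"
  by (rule linearI) (simp_all add: linear_add linear_scale scaleR_add_left)

text \<open>Take a unit vector, its image under \<open>J\<close>, a unit vector orthogonal to both and its image under \<open>J\<close>.\<close>

lemma adapted_frame_exists:
  fixes U :: "(real^4) set"
  assumes "almost_kaehler_chart U g J" and x: "x \<in> U"
  shows "\<exists>E. orthonormal_frame g x E \<and> J x *v E 1 = E 2 \<and> J x *v E 3 = E 4"
proof -
  interpret almost_kaehler_chart U g J by fact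
  have unit: "\<exists>c. metric g x (c *\<^sub>R v) (c *\<^sub>R v) = 1" if "v \<noteq> 0" for v
    using metric_pos[OF x that]
    by (intro exI[of _ "1 / sqrt (metric g x v v)"]) (simp add: metric_simps field_simps)
  have J_perp: "metric g x v (J x *v v) = 0" "metric g x (J x *v v) v = 0" for v
    using J_skew[OF x, of v v] metric_sym[OF x, of "J x *v v" v] by auto
  obtain e1 where e1: "metric g x e1 e1 = 1"
    using unit[of "axis 1 1"] by (metis axis_eq_0_iff zero_neq_one)
  define e2 where "e2 = J x *v e1"
  have "span {e1, e2} \<noteq> UNIV"
  proof
    assume "span {e1, e2} = UNIV"
    then have "dim (UNIV :: (real^4) set) \<le> card {e1, e2}"
      by (intro dim_le_card) auto
    moreover have "card {e1, e2} \<le> 2" by (simp add: card_insert_if)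
    ultimately show False by simp
  qed
  then obtain v where v: "v \<notin> span {e1, e2}" by blast
  define w where "w = v - metric g x v e1 *\<^sub>R e1 - metric g x v e2 *\<^sub>R e2"
  have "w \<noteq> 0"
  proof
    assume "w = 0"
    then have "v = metric g x v e1 *\<^sub>R e1 + metric g x v e2 *\<^sub>R e2"
      unfolding w_def by (simp add: algebra_simps)
    moreover have "metric g x v e1 *\<^sub>R e1 + metric g x v e2 *\<^sub>R e2 \<in> span {e1, e2}"
      by (intro span_add span_scale span_base) auto
    ultimately show False using v by simp
  qed
  then obtain c where c: "metric g x (c *\<^sub>R w) (c *\<^sub>R w) = 1" using unit by blast
  define e3 where "e3 = c *\<^sub>R w"
  define e4 where "e4 = J x *v e3"
  have e2: "metric g x e2 e2 = 1" "metric g x e1 e2 = 0" "metric g x e2 e1 = 0"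
    unfolding e2_def using e1 J_isometry[OF x] J_perp by auto
  have e3: "metric g x e3 e1 = 0" "metric g x e3 e2 = 0" "metric g x e3 e3 = 1"
    using e1 e2 c unfolding e3_def w_def by (auto simp: metric_simps)
  have J2: "J x *v e2 = - e1" unfolding e2_def by (rule J_J[OF x])
  have e4: "metric g x e4 e4 = 1" "metric g x e3 e4 = 0" "metric g x e4 e3 = 0"
    unfolding e4_def using e3 J_isometry[OF x] J_perp by auto
  have e41: "metric g x e4 e1 = 0"
    using J_skew[OF x, of e3 e1] e3 unfolding e4_def e2_def[symmetric] by simp
  have e42: "metric g x e4 e2 = 0"
    using J_skew[OF x, of e3 e2] e3 unfolding e4_def J2 by (simp add: metric_simps)
  define E :: "4 \<Rightarrow> real^4" where "E k = (if k = 1 then e1 else if k = 2 then e2 else if k = 3 then e3 else e4)" for k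
  have "orthonormal_frame g x E"
    unfolding orthonormal_frame_def forall_4 E_def
    using e1 e2 e3 e4 e41 e42 metric_sym[OF x, of e1 e3] metric_sym[OF x, of e2 e3]
      metric_sym[OF x, of e1 e4] metric_sym[OF x, of e2 e4]
    by simp
  then show ?thesis
    by (intro exI[of _ E]) (simp add: E_def e2_def e4_def)
qed

text \<open>The wedge product of any 2-form with a self-dual one is the inner product times the volume form
  \<open>\<Omega> \<and> \<Omega> / 2\<close>, here in components, where \<open>sd_coeff 2\<close> is \<open>\<Omega>\<close>.\<close>

lemma self_dual_wedge_components:
  fixes c a :: "4 \<Rightarrow> 4 \<Rightarrow> real"
  assumes c: "\<And>i j. c i j = - c j i" and a: "\<And>i j. a i j = - a j i"
    and sd: "a 3 4 = a 1 2" "a 2 4 = - a 1 3" "a 2 3 = a 1 4"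
  shows "wedge22 c a i j k l
    = (\<Sum>i\<in>UNIV. \<Sum>j\<in>UNIV. c i j * a i j) / 2 * (wedge22 (sd_coeff 2) (sd_coeff 2) i j k l / 2)"
proof -
  have c0: "c i i = 0" and a0: "a i i = 0" for i using c[of i i] a[of i i] by linarith+
  have n: "c 2 1 = - c 1 2" "c 3 1 = - c 1 3" "c 4 1 = - c 1 4" "c 3 2 = - c 2 3" "c 4 2 = - c 2 4" "c 4 3 = - c 3 4"
    "a 2 1 = - a 1 2" "a 3 1 = - a 1 3" "a 4 1 = - a 1 4" "a 3 2 = - a 1 4" "a 4 2 = a 1 3" "a 4 3 = - a 1 2"
    using a[of 3 2] a[of 4 2] a[of 4 3] sd by (simp_all add: c[of 2 1] c[of 3 1] c[of 4 1] c[of 3 2] c[of 4 2] c[of 4 3]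
        a[of 2 1] a[of 3 1] a[of 4 1])
  have s: "(\<Sum>i\<in>UNIV. \<Sum>j\<in>UNIV. c i j * a i j) / 2
      = c 1 2 * a 1 2 + c 1 3 * a 1 3 + c 1 4 * a 1 4 + c 2 3 * a 1 4 - c 2 4 * a 1 3 + c 3 4 * a 1 2"
    by (simp add: sum_4 c0 a0 n sd)
  have "\<forall>i j k l. wedge22 c a i j k l
    = (c 1 2 * a 1 2 + c 1 3 * a 1 3 + c 1 4 * a 1 4 + c 2 3 * a 1 4 - c 2 4 * a 1 3 + c 3 4 * a 1 2)
      * (wedge22 (sd_coeff 2) (sd_coeff 2) i j k l / 2)"
    unfolding forall_4 wedge22_def
    by (simp add: c0 a0 n sd sd_coeff_def next_axis_def)
  then show ?thesis unfolding s by blast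
qed


section \<open>The trace on a subspace\<close>

text \<open>Instead of a change of basis: the coefficients \<open>c\<^sub>a\<close> with respect to the family \<open>I\<close> are linear, so the
  coordinates of \<open>f b\<close> in the chosen basis \<open>B\<close> can be expanded through \<open>I\<close>, and summation over \<open>B\<close> reassembles
  \<open>I\<^sub>a\<close> from its coordinates.\<close>

lemma trace_on_eq:
  fixes V :: "'v::euclidean_space set"
  assumes V: "subspace V" and K: "finite K"
    and I: "\<And>a. a \<in> K \<Longrightarrow> I a \<in> V" and c: "\<And>a. a \<in> K \<Longrightarrow> linear (c a)"
    and expand: "\<And>v. v \<in> V \<Longrightarrow> v = (\<Sum>a\<in>K. c a v *\<^sub>R I a)"
    and f: "linear f" "\<And>v. v \<in> V \<Longrightarrow> f v \<in> V"
  shows "trace_on V f = (\<Sum>a\<in>K. c a (f (I a)))"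
proof -
  define B where "B = (SOME B. independent B \<and> span B = V)"
  have "\<exists>B. independent B \<and> span B = V"
    using basis_exists[of V] span_subspace[OF _ _ V] by metis
  from someI_ex[OF this] have B: "independent B" "span B = V"
    unfolding B_def[symmetric] by blast+
  have fin: "finite B" using B(1) by (rule independent_imp_finite)
  have "trace_on V f = (\<Sum>b\<in>B. representation B (f b) b)"
    unfolding trace_on_def B_def[symmetric] Let_def ..
  also have "\<dots> = (\<Sum>b\<in>B. \<Sum>a\<in>K. c a (f b) * representation B (I a) b)"
  proof (rule sum.cong[OF refl])
    fix b assume "b \<in> B"
    then have fb: "f b \<in> V" using f(2) B(2) span_base by blast
    have IB: "I a \<in> span B" if "a \<in> K" for a using I[OF that] B(2) by simp
    have "representation B (f b) = representation B (\<Sum>a\<in>K. c a (f b) *\<^sub>R I a)"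
      using expand[OF fb] by simp
    also have "\<dots> = (\<lambda>b'. \<Sum>a\<in>K. representation B (c a (f b) *\<^sub>R I a) b')"
      by (rule representation_sum[OF B(1) span_scale[OF IB]])
    also have "\<dots> = (\<lambda>b'. \<Sum>a\<in>K. c a (f b) * representation B (I a) b')"
      by (intro ext sum.cong refl) (simp add: representation_scale[OF B(1) IB])
    finally show "representation B (f b) b = (\<Sum>a\<in>K. c a (f b) * representation B (I a) b)"
      by simp
  qed
  also have "\<dots> = (\<Sum>a\<in>K. c a (f (\<Sum>b\<in>B. representation B (I a) b *\<^sub>R b)))"
    by (subst sum.swap)
      (simp add: linear_sum[OF f(1)] linear_scale[OF f(1)] linear_sum[OF c] linear_scale[OF c] mult.commute)
  also have "\<dots> = (\<Sum>a\<in>K. c a (f (I a)))"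
    using sum_representation_eq[OF B(1) _ fin subset_refl] I B(2) by simp
  finally show ?thesis .
qed


section \<open>The Weyl tensor on self-dual forms\<close>

text \<open>All contractions at the point \<open>x\<close> are evaluated in one frame with \<open>E\<^sub>2 = J E\<^sub>1\<close> and \<open>E\<^sub>4 = J E\<^sub>3\<close>, in which \<open>J\<close>
  and the self-dual forms have constant components.\<close>

locale adapted_frame = almost_kaehler_chart U g J
  for U :: "(real^4) set" and g J :: "4 matrix_field" +
  fixes x :: "real^4" and E :: "4 \<Rightarrow> real^4"
  assumes x: "x \<in> U" and E: "orthonormal_frame g x E"
    and J_E: "J x *v E 1 = E 2" "J x *v E 3 = E 4"
begin

abbreviation m :: "real^4 \<Rightarrow> real^4 \<Rightarrow> real" where
  "m \<equiv> metric g x"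

definition r :: "4 \<Rightarrow> 4 \<Rightarrow> 4 \<Rightarrow> 4 \<Rightarrow> real" where
  "r i j k l = m (curvature g x (E i) (E j) (E k)) (E l)"

sublocale R: curvature_tensor4 r
proof
  fix i j k l
  show "r i j k l = - r j i k l"
    unfolding r_def using curvature_antisym[of x "E i" "E j" "E k"] by (simp add: metric_simps)
  show "r i j k l = - r i j l k"
    unfolding r_def using curvature_skew[OF x] metric_sym[OF x] by metis
  show "r i j k l + r j k i l + r k i j l = 0"
    unfolding r_def using curvature_bianchi[OF x, of "E i" "E j" "E k"]
    by (metis linear_0[OF metric_linear_left] linear_add[OF metric_linear_left])
qed

lemma m_E: "m (E i) (E j) = (if i = j then 1 else 0)"
  using E unfolding orthonormal_frame_def by blast

lemma frame_orthonormal: "orthonormal_frame g x (frame g x)"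
  unfolding frame_def by (rule someI[of _ E]) (rule E)

lemma contract_frame:
  assumes "\<And>Y. linear (\<lambda>X. B X Y)" "\<And>X. linear (\<lambda>Y. B X Y)"
  shows "(\<Sum>k\<in>UNIV. B (frame g x k) (frame g x k)) = (\<Sum>k\<in>UNIV. B (E k) (E k))"
  by (rule contraction_frame_independent[OF x frame_orthonormal E assms])

lemma ricci_eq: "ricci g x X = (\<Sum>k\<in>UNIV. curvature g x X (E k) (E k))"
  unfolding ricci_def by (intro contract_frame curvature_linear_2 curvature_linear_3 x)

lemma ricci_linear: "linear (ricci g x)"
  unfolding ricci_def[abs_def] by (intro linear_compose_sum curvature_linear_1 x ballI)

lemma ricci_component: "m (ricci g x (E i)) (E l) = R.ric i l"
  unfolding ricci_eq R.ric_def r_def by (rule linear_sum[OF metric_linear_left])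

lemma scalar_curvature_eq: "scalar_curvature g x = R.scal"
proof -
  have "scalar_curvature g x = (\<Sum>i\<in>UNIV. ricci g x (axis i 1) $ i)"
    unfolding scalar_curvature_def trace_def matrix_def by simp
  then show ?thesis
    unfolding trace_frame[OF x E ricci_linear] ricci_component R.scal_def .
qed

lemma weyl_component: "m (weyl g x (E i) (E j) (E k)) (E l) = R.W i j k l"
proof -
  have "R.ric j k = m (ricci g x (E j)) (E k)" for j k by (simp add: ricci_component)
  then show ?thesis
    unfolding weyl_def R.W_def
    by (simp add: metric_simps m_E ricci_component scalar_curvature_eq flip: r_def)
qed

lemma weyl_linear:
  "linear (\<lambda>X. weyl g x X Y Z)" "linear (\<lambda>Y. weyl g x X Y Z)" "linear (\<lambda>Z. weyl g x X Y Z)"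
proof -
  have ric_l: "linear (\<lambda>X. m (ricci g x X) Z)" for Z
    using linear_compose[OF ricci_linear metric_linear_left[of g x Z]] unfolding o_def .
  note l = linear_compose_sub linear_compose_add linear_compose_scale_right curvature_linear_1
    curvature_linear_2 curvature_linear_3 ricci_linear ric_l linear_scaleR_vector
    metric_linear_left metric_linear_right linear_ident x
  show "linear (\<lambda>X. weyl g x X Y Z)" "linear (\<lambda>Y. weyl g x X Y Z)" "linear (\<lambda>Z. weyl g x X Y Z)"
    unfolding weyl_def by (intro l)+
qed

lemma weyl_op_apply: "weyl_op g x A *v Z = (\<Sum>k\<in>UNIV. weyl g x (A *v E k) (E k) Z)"
proof -
  have "linear (\<lambda>Z. \<Sum>k\<in>UNIV. weyl g x (A *v frame g x k) (frame g x k) Z)"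
    by (intro linear_compose_sum weyl_linear ballI)
  moreover have "linear (\<lambda>X. weyl g x (A *v X) Y Z)" for Y
    using linear_compose[OF _ weyl_linear(1)[of Y Z], of "(*v) A"] unfolding o_def by simp
  ultimately show ?thesis
    unfolding weyl_op_def
    by (simp add: matrix_apply contract_frame[of "\<lambda>X Y. weyl g x (A *v X) Y Z"] weyl_linear)
qed

lemma weyl_op_linear: "linear (weyl_op g x)"
proof (rule linearI)
  fix A B :: "real^4^4" and c :: real
  show "weyl_op g x (A + B) = weyl_op g x A + weyl_op g x B"
    by (simp add: matrix_eq weyl_op_apply matrix_vector_mult_add_rdistrib linear_add[OF weyl_linear(1)]
        sum.distrib)
  show "weyl_op g x (c *\<^sub>R A) = c *\<^sub>R weyl_op g x A"
    by (simp add: matrix_eq weyl_op_apply linear_scale[OF weyl_linear(1)] scaleR_sum_right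
        flip: scaleR_matrix_vector_assoc)
qed

definition comp :: "real^4^4 \<Rightarrow> 4 \<Rightarrow> 4 \<Rightarrow> real" where
  "comp A i j = m (A *v E i) (E j)"

definition endo :: "(4 \<Rightarrow> 4 \<Rightarrow> real) \<Rightarrow> real^4^4" where
  "endo c = matrix (\<lambda>X. \<Sum>k\<in>UNIV. m X (E k) *\<^sub>R (\<Sum>p\<in>UNIV. c k p *\<^sub>R E p))"

lemma linear_m_comp: "linear (\<lambda>X. m (A *v X) Y)"
  using linear_compose[OF matrix_vector_mul_linear metric_linear_left[of g x Y]] unfolding o_def .

lemma endo_apply: "endo c *v E i = (\<Sum>p\<in>UNIV. c i p *\<^sub>R E p)"
proof -
  have "endo c *v E i = (\<Sum>k\<in>UNIV. m (E i) (E k) *\<^sub>R (\<Sum>p\<in>UNIV. c k p *\<^sub>R E p))"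
    unfolding endo_def
    by (intro matrix_apply linear_compose_sum linear_scaleR_vector metric_linear_left ballI)
  then show ?thesis by (simp add: m_E if_distrib[of "\<lambda>a. a *\<^sub>R _"] cong: if_cong)
qed

lemma m_sum_E: "m (\<Sum>p\<in>UNIV. c p *\<^sub>R E p) (E j) = c j"
  by (simp add: linear_sum[OF metric_linear_left] metric_simps m_E if_distrib[of "(*) _"] cong: if_cong)

lemma comp_endo: "comp (endo c) i j = c i j"
  unfolding comp_def endo_apply m_sum_E ..

lemma comp_eqI:
  assumes "\<And>i j. comp A i j = comp B i j"
  shows "A = B"
proof -
  have "A *v E i = B *v E i" for i
    using frame_eqI[OF x E, of "A *v E i" "B *v E i"] assms unfolding comp_def by blast
  then have "A *v v = B *v v" for v
    using linear_frame_expansion[OF x E matrix_vector_mul_linear, of A v]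
      linear_frame_expansion[OF x E matrix_vector_mul_linear, of B v] by simp
  then show ?thesis by (simp add: matrix_eq)
qed

lemma comp_linear: "linear (\<lambda>A. comp A i j)"
  by (rule linearI)
    (simp_all add: comp_def matrix_vector_mult_add_rdistrib metric_simps flip: scaleR_matrix_vector_assoc)

lemma zero_on_frame:
  assumes "linear f" "\<And>i. f (E i) = (0 :: real)"
  shows "f X = 0"
  using linear_frame_expansion[OF x E assms(1), of X] assms(2) by simp

lemma skew_iff: "skew g x A \<longleftrightarrow> (\<forall>i j. comp A i j = - comp A j i)"
proof
  assume "skew g x A"
  then show "\<forall>i j. comp A i j = - comp A j i"
    unfolding skew_def comp_def using metric_sym[OF x] by metis
next
  assume *: "\<forall>i j. comp A i j = - comp A j i"
  show "skew g x A"
    unfolding skew_def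
  proof (intro allI)
    fix X Y
    have lin: "linear (\<lambda>X. m (A *v X) Y + m X (A *v Y))" "linear (\<lambda>Y. m (A *v X) Y + m X (A *v Y))" for X Y
      using linear_compose[OF matrix_vector_mul_linear metric_linear_right[of g x X], of A]
      by (auto intro!: linear_compose_add linear_m_comp metric_linear_left metric_linear_right simp: o_def)
    have "m (A *v E i) (E j) + m (E i) (A *v E j) = 0" for i j
      using * metric_sym[OF x, of "E i" "A *v E j"] unfolding comp_def by (metis add.left_inverse)
    from zero_on_frame[OF lin(2) this] have "m (A *v E i) Y + m (E i) (A *v Y) = 0" for i .
    from zero_on_frame[OF lin(1) this] have "m (A *v X) Y + m X (A *v Y) = 0" .
    then show "m (A *v X) Y = - m X (A *v Y)" by simp
  qed
qed

lemma form_inner_comp: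
  "form_inner g x (form_of g x A) (form_of g x B)
    = (\<Sum>i\<in>UNIV. \<Sum>j\<in>UNIV. comp A i j * comp B i j) / 2"
proof -
  let ?F = "frame g x"
  have "(\<Sum>i\<in>UNIV. \<Sum>j\<in>UNIV. m (A *v ?F i) (?F j) * m (B *v ?F i) (?F j))
      = (\<Sum>i\<in>UNIV. \<Sum>j\<in>UNIV. m (A *v E i) (?F j) * m (B *v E i) (?F j))"
    by (rule contract_frame[of "\<lambda>X Y. \<Sum>j\<in>UNIV. m (A *v X) (?F j) * m (B *v Y) (?F j)"];
        intro linear_compose_sum ballI linear_mult_const linear_m_comp)
  also have "\<dots> = (\<Sum>i\<in>UNIV. \<Sum>j\<in>UNIV. m (A *v E i) (E j) * m (B *v E i) (E j))"
    by (intro sum.cong refl contract_frame[of "\<lambda>X Y. m (A *v E _) X * m (B *v E _) Y"]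
        linear_mult_const metric_linear_right)
  finally show ?thesis unfolding form_inner_def form_of_def comp_def by simp
qed

lemma J_comp: "comp (J x) = sd_coeff 2"
proof -
  have J2: "J x *v E 2 = - E 1" "J x *v E 4 = - E 3"
    using J_J[OF x, of "E 1"] J_J[OF x, of "E 3"] by (simp_all add: J_E)
  have "\<forall>i j. comp (J x) i j = sd_coeff 2 i j"
    unfolding forall_4 comp_def by (simp add: J_E J2 metric_simps m_E sd_coeff_def next_axis_def)
  then show ?thesis by blast
qed

lemma J_endo: "J x = endo (sd_coeff 2)"
  by (rule comp_eqI) (simp add: comp_endo J_comp)

lemma wedge22_linear:
  fixes \<alpha> \<beta> :: "real^4 \<Rightarrow> real^4 \<Rightarrow> real"
  assumes "\<And>X. linear (\<alpha> X)" "\<And>Y. linear (\<lambda>X. \<alpha> X Y)" "\<And>X. linear (\<beta> X)" "\<And>Y. linear (\<lambda>X. \<beta> X Y)"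
  shows "linear (\<lambda>X. wedge22 \<alpha> \<beta> X Y Z Q)" "linear (\<lambda>Y. wedge22 \<alpha> \<beta> X Y Z Q)"
    "linear (\<lambda>Z. wedge22 \<alpha> \<beta> X Y Z Q)" "linear (\<lambda>Q. wedge22 \<alpha> \<beta> X Y Z Q)"
proof -
  show "linear (\<lambda>X. wedge22 \<alpha> \<beta> X Y Z Q)" "linear (\<lambda>Y. wedge22 \<alpha> \<beta> X Y Z Q)"
    "linear (\<lambda>Z. wedge22 \<alpha> \<beta> X Y Z Q)" "linear (\<lambda>Q. wedge22 \<alpha> \<beta> X Y Z Q)"
    unfolding wedge22_def
    by (rule linear_compose_add linear_compose_sub linear_mult_const assms)+
qed

text \<open>For the equations on \<open>A\<close>, test self-duality with the forms \<open>e\<^sup>1 \<and> e\<^sup>q\<close> on the frame.  Conversely both sides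
  of the duality are multilinear, so they need to be compared on the frame only.\<close>

lemma hodge_dual_iff:
  assumes A: "skew g x A"
  shows "hodge_dual g J x A A \<longleftrightarrow> comp A 3 4 = comp A 1 2 \<and> comp A 2 4 = - comp A 1 3 \<and> comp A 2 3 = comp A 1 4"
proof
  assume H: "hodge_dual g J x A A"
  have sk: "comp A i j = - comp A j i" for i j using A skew_iff by blast
  have main: "wedge22 c (comp A) 1 2 3 4 = (\<Sum>i\<in>UNIV. \<Sum>j\<in>UNIV. c i j * comp A i j) / 2"
    if "\<And>i j. c i j = - c j i" for c
  proof -
    have "skew g x (endo c)" using that unfolding skew_iff comp_endo by blast
    then have "wedge22 (form_of g x (endo c)) (form_of g x A) (E 1) (E 2) (E 3) (E 4)
        = form_inner g x (form_of g x (endo c)) (form_of g x A) * volume_form g J x (E 1) (E 2) (E 3) (E 4)"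
      using H unfolding hodge_dual_def by blast
    moreover have "wedge22 (form_of g x (endo c)) (form_of g x A) (E 1) (E 2) (E 3) (E 4)
        = wedge22 (comp (endo c)) (comp A) 1 2 3 4"
      unfolding wedge22_def form_of_def comp_def ..
    moreover have "volume_form g J x (E 1) (E 2) (E 3) (E 4) = wedge22 (comp (J x)) (comp (J x)) 1 2 3 4 / 2"
      unfolding volume_form_def fundamental_form_def wedge22_def form_of_def comp_def ..
    moreover have "wedge22 (sd_coeff 2) (sd_coeff 2) 1 2 3 4 = 2"
      by (simp add: wedge22_def sd_coeff_def next_axis_def)
    ultimately show ?thesis
      unfolding form_inner_comp J_comp by (simp add: comp_endo wedge22_def)
  qed
  define e :: "4 \<Rightarrow> 4 \<Rightarrow> 4 \<Rightarrow> 4 \<Rightarrow> real" where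
    "e p q i j = (if i = p \<and> j = q then 1 else if i = q \<and> j = p then - 1 else 0)" for p q i j
  have e: "e p q i j = - e p q j i" if "p \<noteq> q" for p q i j
    using that unfolding e_def by auto
  show "comp A 3 4 = comp A 1 2 \<and> comp A 2 4 = - comp A 1 3 \<and> comp A 2 3 = comp A 1 4"
    using main[of "e 1 2", OF e] main[of "e 1 3", OF e] main[of "e 1 4", OF e]
      sk[of 2 1] sk[of 3 1] sk[of 4 1]
    by (simp add: wedge22_def e_def sum_4)
next
  assume sd: "comp A 3 4 = comp A 1 2 \<and> comp A 2 4 = - comp A 1 3 \<and> comp A 2 3 = comp A 1 4"
  show "hodge_dual g J x A A"
    unfolding hodge_dual_def
  proof (intro allI impI)
    fix C X Y Z Q assume C: "skew g x C"
    define s where "s = form_inner g x (form_of g x C) (form_of g x A)"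
    define d where "d X Y Z Q = wedge22 (form_of g x C) (form_of g x A) X Y Z Q
      - s * volume_form g J x X Y Z Q" for X Y Z Q
    have form_lin: "linear (form_of g x B X)" "linear (\<lambda>X. form_of g x B X Y)" for B X Y
      unfolding form_of_def[abs_def] by (rule metric_linear_right linear_m_comp)+
    have half: "volume_form g J x X Y Z Q = 1/2 * wedge22 (form_of g x (J x)) (form_of g x (J x)) X Y Z Q"
      for X Y Z Q unfolding volume_form_def fundamental_form_def by simp
    have lin: "linear (\<lambda>X. d X Y Z Q)" "linear (\<lambda>Y. d X Y Z Q)" "linear (\<lambda>Z. d X Y Z Q)" "linear (\<lambda>Q. d X Y Z Q)"
      for X Y Z Q
      unfolding d_def half by (intro linear_compose_sub linear_mult_const wedge22_linear form_lin)+
    have "d (E i) (E j) (E k) (E l) = 0" for i j k l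
    proof -
      have w1: "wedge22 (form_of g x C) (form_of g x A) (E i) (E j) (E k) (E l)
          = wedge22 (comp C) (comp A) i j k l"
        unfolding wedge22_def form_of_def comp_def ..
      have w2: "volume_form g J x (E i) (E j) (E k) (E l) = wedge22 (comp (J x)) (comp (J x)) i j k l / 2"
        unfolding volume_form_def fundamental_form_def wedge22_def form_of_def comp_def ..
      have w3: "wedge22 (comp C) (comp A) i j k l
          = (\<Sum>i\<in>UNIV. \<Sum>j\<in>UNIV. comp C i j * comp A i j) / 2
            * (wedge22 (sd_coeff 2) (sd_coeff 2) i j k l / 2)"
        using C A sd unfolding skew_iff by (intro self_dual_wedge_components) blast+
      show ?thesis
        unfolding d_def s_def form_inner_comp w1 w2 w3 J_comp by simp
    qed
    from zero_on_frame[OF lin(4) this] have "d (E i) (E j) (E k) Q = 0" for i j k .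
    from zero_on_frame[OF lin(3) this] have "d (E i) (E j) Z Q = 0" for i j .
    from zero_on_frame[OF lin(2) this] have "d (E i) Y Z Q = 0" for i .
    from zero_on_frame[OF lin(1) this] have "d X Y Z Q = 0" .
    then show "wedge22 (form_of g x C) (form_of g x A) X Y Z Q
        = form_inner g x (form_of g x C) (form_of g x A) * volume_form g J x X Y Z Q"
      unfolding d_def s_def by simp
  qed
qed

lemma self_dual_space_iff:
  "A \<in> self_dual_space g J x \<longleftrightarrow> (\<forall>i j. comp A i j = - comp A j i)
    \<and> comp A 3 4 = comp A 1 2 \<and> comp A 2 4 = - comp A 1 3 \<and> comp A 2 3 = comp A 1 4"
  unfolding self_dual_space_def mem_Collect_eq skew_iff[symmetric] using hodge_dual_iff by blast

lemma subspace_self_dual: "subspace (self_dual_space g J x)"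
proof (rule subspaceI)
  show "0 \<in> self_dual_space g J x"
    unfolding self_dual_space_iff by (simp add: linear_0[OF comp_linear])
next
  fix A B assume "A \<in> self_dual_space g J x" "B \<in> self_dual_space g J x"
  then show "A + B \<in> self_dual_space g J x"
    unfolding self_dual_space_iff linear_add[OF comp_linear] by (metis minus_add_distrib)
next
  fix c A assume "A \<in> self_dual_space g J x"
  then show "c *\<^sub>R A \<in> self_dual_space g J x"
    unfolding self_dual_space_iff linear_scale[OF comp_linear] by (metis scaleR_minus_right)
qed

lemma endo_self_dual: "a \<in> {2, 3, 4} \<Longrightarrow> endo (sd_coeff a) \<in> self_dual_space g J x"
  unfolding self_dual_space_iff comp_endo forall_4
  by (auto simp: sd_coeff_def next_axis_def)

lemma self_dual_expansion:
  assumes "A \<in> self_dual_space g J x"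
  shows "A = (\<Sum>a\<in>{2, 3, 4}. comp A 1 a *\<^sub>R endo (sd_coeff a))"
proof (rule comp_eqI)
  fix i j
  have sk: "comp A i j = - comp A j i" for i j using assms self_dual_space_iff by blast
  have z: "comp A i i = 0" for i using sk[of i i] by linarith
  have sd: "comp A 3 4 = comp A 1 2" "comp A 2 4 = - comp A 1 3" "comp A 2 3 = comp A 1 4"
    using assms self_dual_space_iff by blast+
  note n = sk[of 2 1] sk[of 3 1] sk[of 4 1] sk[of 3 2] sk[of 4 2] sk[of 4 3]
  have "\<forall>i j. comp A i j = (\<Sum>a\<in>{2, 3, 4}. comp A 1 a * sd_coeff a i j)"
    unfolding forall_4 by (simp add: n z sd sd_coeff_def next_axis_def)
  then have "comp A i j = (\<Sum>a\<in>{2, 3, 4}. comp A 1 a * sd_coeff a i j)" by blast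
  then show "comp A i j = comp (\<Sum>a\<in>{2, 3, 4}. comp A 1 a *\<^sub>R endo (sd_coeff a)) i j"
    by (simp add: linear_add[OF comp_linear] linear_scale[OF comp_linear] comp_endo)
qed

lemma weyl_op_comp: "comp (weyl_op g x (endo (sd_coeff a))) i j = R.weyl_form a i j"
  unfolding comp_def weyl_op_apply endo_apply R.weyl_form_def
  by (simp add: linear_sum[OF weyl_linear(1)] linear_scale[OF weyl_linear(1)]
      linear_sum[OF metric_linear_left] metric_simps weyl_component)

lemma weyl_op_self_dual:
  assumes "A \<in> self_dual_space g J x"
  shows "weyl_op g x A \<in> self_dual_space g J x"
proof -
  have "weyl_op g x (endo (sd_coeff a)) \<in> self_dual_space g J x" if "a \<in> {2, 3, 4}" for a
    using R.weyl_form_skew R.weyl_form_self_dual[OF that] unfolding self_dual_space_iff weyl_op_comp by blast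
  then have "(\<Sum>a\<in>{2, 3, 4}. comp A 1 a *\<^sub>R weyl_op g x (endo (sd_coeff a))) \<in> self_dual_space g J x"
    by (intro subspace_sum subspace_scale subspace_self_dual)
  moreover have "weyl_op g x A = (\<Sum>a\<in>{2, 3, 4}. comp A 1 a *\<^sub>R weyl_op g x (endo (sd_coeff a)))"
    by (subst self_dual_expansion[OF assms])
      (simp add: linear_add[OF weyl_op_linear] linear_scale[OF weyl_op_linear])
  ultimately show ?thesis by simp
qed

lemma weyl_plus_norm_sq_eq:
  "weyl_plus_norm_sq g J x = (R.weyl_form 2 1 2)\<^sup>2 + (R.weyl_form 3 1 3)\<^sup>2 + (R.weyl_form 4 1 4)\<^sup>2
    + 2 * ((R.weyl_form 2 1 3)\<^sup>2 + (R.weyl_form 2 1 4)\<^sup>2 + (R.weyl_form 3 1 4)\<^sup>2)"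
proof -
  let ?I = "\<lambda>a. endo (sd_coeff a)"
  have lin: "linear (weyl_op g x \<circ> weyl_op g x)"
    by (rule linear_compose[OF weyl_op_linear weyl_op_linear])
  have W: "weyl_op g x (?I a) = (\<Sum>b\<in>{2, 3, 4}. R.weyl_form a 1 b *\<^sub>R ?I b)" if "a \<in> {2, 3, 4}" for a
    using self_dual_expansion[OF weyl_op_self_dual[OF endo_self_dual[OF that]]]
    unfolding weyl_op_comp .
  have "weyl_plus_norm_sq g J x = (\<Sum>a\<in>{2, 3, 4}. comp ((weyl_op g x \<circ> weyl_op g x) (?I a)) 1 a)"
    unfolding weyl_plus_norm_sq_def
    by (rule trace_on_eq[OF subspace_self_dual _ endo_self_dual comp_linear self_dual_expansion lin])
      (auto intro: weyl_op_self_dual)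
  also have "\<dots> = (\<Sum>a\<in>{2, 3, 4}. \<Sum>b\<in>{2, 3, 4}. R.weyl_form a 1 b * R.weyl_form b 1 a)"
    by (intro sum.cong refl)
      (simp only: o_apply W linear_sum[OF weyl_op_linear] linear_scale[OF weyl_op_linear]
        linear_sum[OF comp_linear] linear_scale[OF comp_linear] weyl_op_comp real_scaleR_def)
  finally show ?thesis
    by (simp add: R.weyl_form_sym power2_eq_square)
qed

lemma star_scal_eq:
  "R.star_scal = (\<Sum>k\<in>UNIV. \<Sum>l\<in>UNIV. m (curvature g x (E k) (E l) (J x *v E l)) (J x *v E k))"
  unfolding R.star_scal_def J_endo endo_apply r_def
  by (simp add: linear_sum[OF curvature_linear_3[OF x]] linear_scale[OF curvature_linear_3[OF x]]
      linear_sum[OF metric_linear_left] linear_sum[OF metric_linear_right] metric_simps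
      sum_distrib_left mult_ac)

lemma scal_eq: "R.scal = (\<Sum>k\<in>UNIV. \<Sum>l\<in>UNIV. m (curvature g x (E k) (E l) (E l)) (E k))"
  unfolding R.scal_def R.ric_def r_def ..

text \<open>The entry of \<open>W\<^sub>+\<close> at \<open>\<Omega>\<close> exceeds its value in the Kaehler case by a multiple of \<open>|\<nabla>J|\<^sup>2\<close>.\<close>

lemma weyl_form_T:
  "R.weyl_form 2 1 2 = scalar_curvature g x / 3
    + (\<Sum>k\<in>UNIV. \<Sum>l\<in>UNIV. m (T x (E k) (E l)) (T x (E k) (E l))) / 4"
proof -
  have frames: "\<exists>E. orthonormal_frame g y E" if "y \<in> U" for y
    using adapted_frame_exists[OF almost_kaehler_chart_axioms that] by blast
  show ?thesis
    using star_scalar_curvature[OF frames x E]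
    unfolding scal_eq[symmetric] star_scal_eq[symmetric] R.weyl_form_star scalar_curvature_eq by simp
qed

lemma T_zero_iff:
  "(\<forall>X Y. T x X Y = 0) \<longleftrightarrow> (\<Sum>k\<in>UNIV. \<Sum>l\<in>UNIV. m (T x (E k) (E l)) (T x (E k) (E l))) \<le> 0"
proof
  assume le: "(\<Sum>k\<in>UNIV. \<Sum>l\<in>UNIV. m (T x (E k) (E l)) (T x (E k) (E l))) \<le> 0"
  have pos: "0 \<le> m X X" for X
    using metric_pos[OF x, of X] by (cases "X = 0") (auto simp: metric_simps)
  have nn: "0 \<le> (\<Sum>l\<in>UNIV. m (T x (E k) (E l)) (T x (E k) (E l)))" for k
    by (intro sum_nonneg pos)
  have "0 \<le> (\<Sum>k\<in>UNIV. \<Sum>l\<in>UNIV. m (T x (E k) (E l)) (T x (E k) (E l)))"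
    by (intro sum_nonneg pos)
  then have "(\<Sum>k\<in>UNIV. \<Sum>l\<in>UNIV. m (T x (E k) (E l)) (T x (E k) (E l))) = 0"
    using le by simp
  then have "(\<Sum>l\<in>UNIV. m (T x (E k) (E l)) (T x (E k) (E l))) = 0" for k
    by (simp add: sum_nonneg_eq_0_iff nn)
  then have "m (T x (E k) (E l)) (T x (E k) (E l)) = 0" for k l
    by (simp add: sum_nonneg_eq_0_iff pos)
  then have "T x (E k) (E l) = 0" for k l
    using metric_pos[OF x, of "T x (E k) (E l)"] by (cases "T x (E k) (E l) = 0") auto
  then have "T x (E k) Y = 0" for k Y
    using linear_frame_expansion[OF x E T_linear_2[OF x], of "E k" Y] by simp
  then show "\<forall>X Y. T x X Y = 0"
    using linear_frame_expansion[OF x E T_linear_1[OF x]] by (metis (no_types, lifting) scaleR_zero_right sum.neutral)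
qed (simp add: metric_simps)

text \<open>A diagonal entry \<open>w\<close> of a symmetric trace-free \<open>3 \<times> 3\<close> matrix satisfies \<open>w\<^sup>2 \<le> 2/3 |W\<^sub>+|\<^sup>2\<close>, because the other two
  diagonal entries \<open>a\<close> and \<open>b\<close> add up to \<open>-w\<close>.  Under the hypothesis this reads \<open>w\<^sup>2 \<le> (S/3)\<^sup>2\<close>.  As \<open>S \<ge> 0\<close>, it
  gives \<open>w \<le> S/3\<close>, and \<open>\<nabla>J\<close> accounts for the excess of \<open>w\<close> over \<open>S/3\<close>.\<close>

lemma T_zero_of_weyl:
  assumes S: "0 \<le> scalar_curvature g x"
    and W: "weyl_plus_norm_sq g J x = (scalar_curvature g x)\<^sup>2 / 6"
  shows "T x X Y = 0"
proof -
  define S where "S = scalar_curvature g x"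
  define w a b where "w = R.weyl_form 2 1 2" and "a = R.weyl_form 3 1 3" and "b = R.weyl_form 4 1 4"
  have le: "w\<^sup>2 + a\<^sup>2 + b\<^sup>2 \<le> S\<^sup>2 / 6"
    using W unfolding weyl_plus_norm_sq_eq w_def a_def b_def S_def
    by (smt (verit) zero_le_power2)
  have wab: "w = - (a + b)" using R.weyl_form_trace unfolding w_def a_def b_def by simp
  have "w\<^sup>2 \<le> 2 * (a\<^sup>2 + b\<^sup>2)"
    unfolding wab using zero_le_power2[of "a - b"] by (simp add: power2_eq_square algebra_simps)
  with le have "w\<^sup>2 \<le> S\<^sup>2 / 9" by (simp add: field_simps)
  then have "w\<^sup>2 \<le> (S / 3)\<^sup>2" by (simp add: power_divide)
  then have "w \<le> S / 3"
    by (rule power2_le_imp_le) (simp add: S_def S)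
  then show ?thesis
    using weyl_form_T T_zero_iff unfolding w_def S_def by fastforce
qed

text \<open>If \<open>\<nabla>J\<close> vanishes near \<open>x\<close>, so does \<open>\<nabla>\<^sup>2J\<close>, and by the Ricci identity the curvature commutes with \<open>J\<close>.  Then
  \<open>W\<^sub>+\<close> is diagonal with entries \<open>S/3\<close>, \<open>-S/6\<close>, \<open>-S/6\<close>.\<close>

lemma weyl_of_T_zero:
  assumes T0: "\<And>y X Y. y \<in> U \<Longrightarrow> T y X Y = 0"
  shows "weyl_plus_norm_sq g J x = (scalar_curvature g x)\<^sup>2 / 6"
proof -
  have "N V (\<lambda>y. T y X Y) x = 0" for V X Y
  proof -
    have "N V (\<lambda>y. T y X Y) x = N V (\<lambda>_. 0) x" by (rule N_cong[OF x T0])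
    then show ?thesis by (simp add: N_const linear_0[OF christoffel_linear_right[OF x]])
  qed
  then have "T2 x V X Y = 0" for V X Y
    unfolding T2_def by (simp add: T0[OF x])
  then have comm: "curvature g x V X (J x *v Y) = J x *v curvature g x V X Y" for V X Y
    using T2_commutator[OF x, of V X Y] by simp
  have J4: "J x *v E 4 = - E 3" using J_J[OF x, of "E 3"] by (simp add: J_E)
  have "r i j 2 4 = r i j 1 3" for i j
    unfolding r_def J_E[symmetric] comm by (rule J_isometry[OF x])
  moreover have "r i j 2 3 = - r i j 1 4" for i j
  proof -
    have "m (curvature g x (E i) (E j) (J x *v E 1)) (J x *v E 4) = r i j 1 4"
      unfolding comm r_def by (rule J_isometry[OF x])
    then show ?thesis unfolding J_E J4 r_def by (simp add: metric_simps)
  qed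
  note K = R.weyl_form_kaehler[OF calculation this]
  have w: "R.weyl_form 2 1 2 = R.scal / 3" using R.weyl_form_trace K by simp
  show ?thesis
    unfolding weyl_plus_norm_sq_eq K w scalar_curvature_eq by (simp add: power2_eq_square)
qed

end


section \<open>From charts to the manifold\<close>

lemma almost_kaehler_imp_chart:
  fixes A :: "('a, 'n::finite) chart set"
  assumes "almost_kaehler M A g J" and c: "c \<in> A"
  shows "almost_kaehler_chart (coords c) (g c) (J c)"
proof -
  have ah: "almost_hermitian M A g J"
    and cl: "\<forall>x\<in>coords c. \<forall>X Y Z. ext_deriv2 (fundamental_form (g c) (J c)) x X Y Z = 0"
    using assms unfolding almost_kaehler_def by auto
  have "is_chart M c"
    using ah c unfolding almost_hermitian_def smooth_manifold_def by blast
  then have op: "open (coords c)" unfolding is_chart_def by blast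
  have sm: "smooth_on (coords c) (g c)" "smooth_on (coords c) (J c)"
    using ah c unfolding almost_hermitian_def riemannian_metric_def bilinear_form_field_def endomorphism_field_def
    by blast+
  have met: "\<forall>x\<in>coords c. (\<forall>X Y. metric (g c) x X Y = metric (g c) x Y X)
      \<and> (\<forall>X. X \<noteq> 0 \<longrightarrow> 0 < metric (g c) x X X)"
    using ah c unfolding almost_hermitian_def riemannian_metric_def by blast
  have JJ: "\<forall>x\<in>coords c. J c x ** J c x = - mat 1 \<and> skew (g c) x (J c x)"
    using ah c unfolding almost_hermitian_def by blast
  then have sk: "\<forall>x\<in>coords c. \<forall>X Y. metric (g c) x (J c x *v X) Y = - metric (g c) x X (J c x *v Y)"
    unfolding skew_def by blast
  have neg: "(- mat 1 :: real^'n^'n) *v X = - X" for X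
    using matrix_vector_mult_diff_rdistrib[of 0 "mat 1 :: real^'n^'n" X] by simp
  show ?thesis
  proof
    show "J c x *v (J c x *v X) = - X" if "x \<in> coords c" for x X
      using JJ that by (simp add: matrix_vector_mul_assoc neg)
  qed (use op smooth_on_C2_on[OF op sm(1)] smooth_on_C2_on[OF op sm(2)] met sk cl in blast)+
qed

theorem theorem4p1:
  fixes M :: "'a topology" and A :: "('a, 4) chart set" and g J :: "('a, 4) tensor2"
  assumes "almost_kaehler M A g J"
    and "\<forall>c\<in>A. \<forall>x\<in>coords c. scalar_curvature (g c) x \<ge> 0"
  shows "kaehler M A g J \<longleftrightarrow>
    (\<forall>c\<in>A. \<forall>x\<in>coords c. weyl_plus_norm_sq (g c) (J c) x = (scalar_curvature (g c) x)\<^sup>2 / 6)"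
proof -
  have frame_at: "\<exists>E. adapted_frame (coords c) (g c) (J c) x E" if "c \<in> A" "x \<in> coords c" for c x
  proof -
    have chart: "almost_kaehler_chart (coords c) (g c) (J c)"
      using almost_kaehler_imp_chart[OF assms(1) that(1)] .
    then show ?thesis
      using adapted_frame_exists[OF chart that(2)] that(2)
      unfolding adapted_frame_def adapted_frame_axioms_def by blast
  qed
  have "kaehler M A g J \<longleftrightarrow>
      (\<forall>c\<in>A. \<forall>x\<in>coords c. \<forall>X Y. nabla_endo (g c) (J c) x X Y = 0)"
    using assms(1) unfolding kaehler_def almost_kaehler_def by blast
  also have "\<dots> \<longleftrightarrow> (\<forall>c\<in>A. \<forall>x\<in>coords c.
      weyl_plus_norm_sq (g c) (J c) x = (scalar_curvature (g c) x)\<^sup>2 / 6)"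
  proof (intro iffI ballI allI)
    fix c x
    assume T0: "\<forall>c\<in>A. \<forall>x\<in>coords c. \<forall>X Y. nabla_endo (g c) (J c) x X Y = 0"
      and c: "c \<in> A" "x \<in> coords c"
    obtain E where "adapted_frame (coords c) (g c) (J c) x E" using frame_at[OF c] ..
    then show "weyl_plus_norm_sq (g c) (J c) x = (scalar_curvature (g c) x)\<^sup>2 / 6"
      by (rule adapted_frame.weyl_of_T_zero) (use T0 c in blast)
  next
    fix c x X Y
    assume W: "\<forall>c\<in>A. \<forall>x\<in>coords c. weyl_plus_norm_sq (g c) (J c) x = (scalar_curvature (g c) x)\<^sup>2 / 6"
      and c: "c \<in> A" "x \<in> coords c"
    obtain E where "adapted_frame (coords c) (g c) (J c) x E" using frame_at[OF c] ..
    then show "nabla_endo (g c) (J c) x X Y = 0"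
      by (rule adapted_frame.T_zero_of_weyl) (use W assms(2) c in blast)+
  qed
  finally show ?thesis .
qed

end
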